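(* Let $d\ge 1$, $(a_1,\dots,a_d),(b_1,\dots,b_d)\in(0,\infty)^d$ and $$\Lambda=\prod_{l=1}^d a_l\mathbb{Z}^{1/2}\times\prod_{l=1}^d b_l\mathbb{Z}^{1/2}\subset\mathbb{R}^{2d}.$$ If $\max_{1\le l\le d}\min\{a_l,b_l\}<1$, then $\Lambda$ does Gabor phase retrieval. Moreover, if $a_{l_0}=b_{l_0}>1$ for some $1\le l_0\le d$, then $\Lambda$ does not do Gabor phase retrieval.
   Context: Let $\varphi_d(x)=e^{-\pi|x|^2}$, $x\in\mathbb{R}^d$. For $f\in L^2(\mathbb{R}^d)$ the $d$-dimensional Gabor transform is $V_{\varphi_d}f(t,\omega)=\int_{\mathbb{R}^d} f(x)\varphi_d(x-t)e^{-2\pi i\langle x,\omega\rangle}\,dx$, $t,\omega\in\mathbb{R}^d$. A set $\Lambda\subset\mathbb{R}^{2d}$ does Gabor phase retrieval if, for all $f_1,f_2\in L^2(\mathbb{R}^d)$, the condition $|V_{\varphi_d}f_1(t,\omega)|=|V_{\varphi_d}f_2(t,\omega)|$ for all $(t,\omega)\in\Lambda$ implies that there is a real constant $\alpha$ with $f_1=e^{i\alpha}f_2$ almost everywhere. $\mathbb{Z}^{1/2}:=\{\pm n^{1/2}: n\ge 0,\ n\in\mathbb{Z}\}$ and $a\mathbb{Z}^{1/2}=\{a\lambda:\lambda\in\mathbb{Z}^{1/2}\}$. *)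

theory Defs
  imports "HOL-Analysis.Analysis"
begin

definition gaussian :: "real ^ 'd \<Rightarrow> real" where
  "gaussian x = exp (- pi * (norm x)\<^sup>2)"

(* Representatives of the classes in L^2(R^d); equality in L^2 is equality almost everywhere. *)
definition L2_functions :: "(real ^ 'd \<Rightarrow> complex) set" where
  "L2_functions =
     {f \<in> borel_measurable lebesgue. integrable lebesgue (\<lambda>x. (norm (f x))\<^sup>2)}"

definition gabor :: "(real ^ 'd \<Rightarrow> complex) \<Rightarrow> real ^ 'd \<Rightarrow> real ^ 'd \<Rightarrow> complex" where
  "gabor f t \<omega> =
     (LINT x|lebesgue. f x * of_real (gaussian (x - t)) * exp (- 2 * of_real pi * \<i> * of_real (x \<bullet> \<omega>)))"

(* The phase space R^(2d) is represented as the product of two copies of R^d. *)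
definition gabor_phase_retrieval :: "((real ^ 'd) \<times> (real ^ 'd)) set \<Rightarrow> bool" where
  "gabor_phase_retrieval \<Lambda> \<longleftrightarrow>
     (\<forall>f1 \<in> L2_functions. \<forall>f2 \<in> L2_functions.
        (\<forall>(t, \<omega>) \<in> \<Lambda>. norm (gabor f1 t \<omega>) = norm (gabor f2 t \<omega>)) \<longrightarrow>
        (\<exists>\<alpha>::real. AE x in lebesgue. f1 x = exp (\<i> * of_real \<alpha>) * f2 x))"

definition sqrt_ints :: "real set" where
  "sqrt_ints = {s. \<exists>n::int. n \<ge> 0 \<and> (s = sqrt (of_int n) \<or> s = - sqrt (of_int n))}"

definition sqrt_lattice :: "real ^ 'd \<Rightarrow> real ^ 'd \<Rightarrow> ((real ^ 'd) \<times> (real ^ 'd)) set" where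
  "sqrt_lattice a b =
     {t. \<forall>l. t $ l \<in> (\<lambda>s. a $ l * s) ` sqrt_ints} \<times>
     {\<omega>. \<forall>l. \<omega> $ l \<in> (\<lambda>s. b $ l * s) ` sqrt_ints}"

end

theory Submission
  imports Defs "HOL-Complex_Analysis.Conformal_Mappings" "HOL-Probability.Distributions"
    "HOL-Real_Asymp.Real_Asymp"
begin

text \<open>
  The Gabor transform at \<open>(t, \<omega>)\<close> is, up to a Gaussian factor, an entire function \<open>F\<close> on
  \<open>\<complex>\<^sup>d\<close> at \<open>z = t - i \<omega>\<close>, with \<open>|F z| \<le> C exp (\<pi> |Re z|\<^sup>2)\<close>. In one
  variable with, say, \<open>a < 1\<close>, the difference of \<open>|V f1|\<^sup>2\<close> and \<open>|V f2|\<^sup>2\<close> on a line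
  \<open>\<omega> = const\<close> extends to an entire function \<open>K\<close> with \<open>|K z| \<le> C exp (2 \<pi> (Im z)\<^sup>2)\<close> that vanishes at
  \<open>a \<surd>n\<close>; Carlson's theorem for \<open>K (\<surd>w)\<close> gives \<open>K = 0\<close>. So \<open>|F1| = |F2|\<close> on the
  parallel lines of height \<open>b \<surd>n\<close>. Reflecting in two of these lines shows that \<open>F1 / F2\<close> has
  periods \<open>2 i b (\<surd>m - \<surd>n)\<close>, which are arbitrarily small, so it is constant. Applied to one
  coordinate after the other this gives \<open>|F1| = |F2|\<close> on \<open>\<complex>\<^sup>d\<close>, hence on every complex line,
  hence \<open>F1 = u F2\<close> with \<open>|u| = 1\<close>. If \<open>a = b > 1\<close> in one coordinate, two superpositions of
  chirped Gaussians form a counterexample.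
\<close>

section \<open>Carlson's theorem\<close>

text \<open>The threshold 1 comes from Carlson's theorem. The substitution \<open>z = sqrt w\<close>
  turns the growth \<open>exp (2 pi (Im z)^2)\<close> into \<open>exp (pi |Im w|)\<close> and the
  zeros into \<open>a^2 n\<close>; a nonzero function of this type cannot vanish on a sequence of
  density \<open>1 / a^2 > 1\<close>, whereas \<open>sin (pi w)\<close> shows that density 1 is
  allowed. The same threshold returns in the counterexample: a chirp in step with a lattice of
  constant \<open>c\<close> is square integrable exactly when \<open>c > 1\<close>.

  The obstacle to dividing \<open>F1\<close> by \<open>F2\<close> is their zeros. All identities are
  therefore kept cross-multiplied, as \<open>F1 w * F2 u = F2 w * F1 u\<close>, and common factors
  are cancelled by the identity theorem. The return from \<open>F1 = u F2\<close> to
  \<open>f1\<close> and \<open>f2\<close> rests on the injectivity of the Fourier transform on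
  integrable functions, which is obtained by enlarging a class of multipliers from sines to
  indicators of Borel sets.\<close>

lemma holomorphic_quotient_simple_zeros:
  fixes E S :: "complex \<Rightarrow> complex"
  assumes E: "E holomorphic_on U" and S: "S holomorphic_on U" and U: "open U"
    and zeros: "\<And>z. z \<in> U \<Longrightarrow> S z = 0 \<Longrightarrow> E z = 0 \<and> deriv S z \<noteq> 0"
  obtains g where "g holomorphic_on U" "\<And>z. z \<in> U \<Longrightarrow> E z = g z * S z"
proof
  \<comment> \<open>The value at a zero of \<open>S\<close> is the limit given by l'Hopital's
    rule.\<close>
  define g where "g = (\<lambda>z. if S z = 0 then deriv E z / deriv S z else E z / S z)"
  show "E z = g z * S z" if "z \<in> U" for z
    using zeros[OF that] by (auto simp: g_def)
  have nbhd: "\<exists>V. open V \<and> z0 \<in> V \<and> g holomorphic_on V" if z0: "z0 \<in> U" for z0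
  proof (cases "S z0 = 0")
    case False
    define V where "V = U \<inter> S -` (- {0})"
    have "open V"
      unfolding V_def using S U
      by (intro continuous_open_preimage holomorphic_on_imp_continuous_on) auto
    moreover have "(\<lambda>z. E z / S z) holomorphic_on V"
      by (intro holomorphic_on_divide holomorphic_on_subset[OF E] holomorphic_on_subset[OF S]) (auto simp: V_def)
    then have "g holomorphic_on V"
      by (rule holomorphic_transform) (auto simp: V_def g_def)
    moreover have "z0 \<in> V" using z0 False by (simp add: V_def)
    ultimately show ?thesis by (intro exI[of _ V] conjI)
  next
    case True
    \<comment> \<open>Dividing numerator and denominator by \<open>z - z0\<close> removes the
      singularity: \<open>s z0 = deriv S z0\<close> is nonzero, so \<open>e / s\<close> is
      holomorphic near \<open>z0\<close>.\<close>
    define s where "s = (\<lambda>z. if z = z0 then deriv S z0 else (S z - S z0) / (z - z0))"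
    define e where "e = (\<lambda>z. if z = z0 then deriv E z0 else (E z - E z0) / (z - z0))"
    have hs: "s holomorphic_on U" unfolding s_def by (rule pole_lemma_open[OF S U])
    have he: "e holomorphic_on U" unfolding e_def by (rule pole_lemma_open[OF E U])
    define V where "V = U \<inter> s -` (- {0})"
    have "open V"
      unfolding V_def using hs U
      by (intro continuous_open_preimage holomorphic_on_imp_continuous_on) auto
    moreover have "(\<lambda>z. e z / s z) holomorphic_on V"
      by (intro holomorphic_on_divide holomorphic_on_subset[OF he] holomorphic_on_subset[OF hs]) (auto simp: V_def)
    then have "g holomorphic_on V"
    proof (rule holomorphic_transform)
      fix z assume "z \<in> V"
      then show "e z / s z = g z"
        using zeros[OF z0 True] True by (cases "z = z0") (simp_all add: V_def g_def e_def s_def)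
    qed
    moreover have "z0 \<in> V" using zeros[OF z0 True] z0 by (auto simp: V_def s_def)
    ultimately show ?thesis by (intro exI[of _ V] conjI)
  qed
  show "g holomorphic_on U"
    unfolding holomorphic_on_def
  proof
    fix z assume "z \<in> U"
    from nbhd[OF this] obtain V where "open V" "z \<in> V" "g holomorphic_on V" by blast
    then have "g field_differentiable at z" using holomorphic_on_imp_differentiable_at by blast
    then show "g field_differentiable at z within U" by (rule field_differentiable_at_within)
  qed
qed

text \<open>For \<open>z = x + i y\<close>,
  \<open>4 |sin z|^2 = exp (2 y) + exp (- 2 y) - 2 cos (2 x)\<close>. The cosine helps where it is
  -1 and is dominated once \<open>|y| >= 1\<close>: these are the vertical and the horizontal sides
  of the rectangle in the next lemma.\<close>

lemma norm_sin_lower_bound: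
  fixes z :: complex
  assumes "cos (2 * Re z) = - 1 \<or> \<bar>Im z\<bar> \<ge> 1"
  shows "exp \<bar>Im z\<bar> / 4 \<le> norm (sin z)"
proof -
  define m where "m = \<bar>Im z\<bar>"
  have e: "exp (2 * Im z) + inverse (exp (2 * Im z)) = exp (2 * m) + inverse (exp (2 * m))"
    by (cases "Im z \<ge> 0") (auto simp: m_def exp_minus)
  have p: "inverse (exp (2 * m)) \<ge> 0" by simp
  have aux: "x / 16 \<le> (x + y - 2 * c) / 4" if "x / 4 \<le> x - 2 * c" "0 \<le> y" for x y c :: real
    using that by (simp add: field_simps)
  have "exp (2 * m) / 4 \<le> exp (2 * m) - 2 * cos (2 * Re z)"
    using assms
  proof
    assume "\<bar>Im z\<bar> \<ge> 1"
    have "exp (2::real) \<ge> 4"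
      using exp_ge_add_one_self[of "1::real"] power_mono[of 2 "exp (1::real)" 2] exp_double[of "1::real"]
      by simp
    moreover have "exp 2 \<le> exp (2 * m)" using \<open>\<bar>Im z\<bar> \<ge> 1\<close> by (simp add: m_def)
    ultimately show ?thesis using cos_le_one[of "2 * Re z"] by linarith
  qed (use exp_gt_zero[of "2 * m"] in linarith)
  then have "exp (2 * m) / 16 \<le> (exp (2 * m) + inverse (exp (2 * m)) - 2 * cos (2 * Re z)) / 4"
    by (rule aux[OF _ p])
  then have "(exp m / 4)\<^sup>2 \<le> (norm (sin z))\<^sup>2"
    unfolding norm_sin_squared e by (simp add: power_divide exp_double)
  then show ?thesis unfolding m_def by (rule power2_le_imp_le) simp
qed

text \<open>
  Dividing by the sine leaves a function \<open>g\<close> that decays like \<open>exp (- \<delta> |Im w|)\<close> on suitable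
  contours. The factor \<open>exp (- \<epsilon> w Ln w)\<close> costs only half of that decay and beats
  \<open>exp (K w)\<close> for every \<open>K\<close>, so that the maximum principle applies with \<open>\<epsilon>\<close> fixed and
  \<open>K\<close> arbitrarily large.
\<close>

lemma carlson_half_plane:
  fixes E :: "complex \<Rightarrow> complex"
  assumes E: "E holomorphic_on {w. Re w > 0}"
    and growth: "\<And>w. Re w > 0 \<Longrightarrow> norm (E w) \<le> C * exp (pi * \<bar>Im w\<bar>)"
    and zeros: "\<And>n::nat. n \<ge> 1 \<Longrightarrow> E (of_real (lam * real n)) = 0"
    and lam: "0 < lam" "lam < 1"
    and x: "x > lam / 2"
  shows "E (of_real x) = 0"
proof -
  define U where "U = {w::complex. Re w > 0}"
  define S where "S = (\<lambda>w::complex. sin (of_real (pi / lam) * w))"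
  have openU: "open U" unfolding U_def by (rule open_halfspace_Re_gt)
  have hS: "S holomorphic_on U" unfolding S_def by (intro holomorphic_intros)
  have dS: "deriv S w = of_real (pi / lam) * cos (of_real (pi / lam) * w)" for w
    unfolding S_def by (rule DERIV_imp_deriv) (use lam in \<open>auto intro!: derivative_eq_intros\<close>)
  have zS: "E w = 0 \<and> deriv S w \<noteq> 0" if "w \<in> U" "S w = 0" for w
  proof -
    from that(2) obtain n :: int where n: "of_real (pi / lam) * w = of_real (of_int n * pi)"
      unfolding S_def sin_eq_0 by auto
    have w: "w = of_real (lam * of_int n)"
    proof -
      have "w = of_real (lam / pi) * (of_real (pi / lam) * w)" using lam by simp
      also have "\<dots> = of_real (lam * of_int n)" unfolding n using lam by simp
      finally show ?thesis .
    qed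
    then have "n > 0" using that(1) lam by (auto simp: U_def zero_less_mult_iff)
    then have "E w = 0" using zeros[of "nat n"] w by simp
    moreover have "cos (of_real (pi / lam) * w) \<noteq> 0"
      using that(2) sin_cos_squared_add[of "of_real (pi / lam) * w"] unfolding S_def by auto
    ultimately show ?thesis using lam by (simp add: dS)
  qed
  obtain g where hg: "g holomorphic_on U" and g: "\<And>w. w \<in> U \<Longrightarrow> E w = g w * S w"
    using holomorphic_quotient_simple_zeros[OF E[folded U_def] hS openU zS] by metis
  \<comment> \<open>The excess of the growth of \<open>S\<close> in imaginary directions over that
    of \<open>E\<close>.\<close>
  define \<delta> where "\<delta> = pi / lam - pi"
  have \<delta>: "\<delta> > 0" using lam by (simp add: \<delta>_def field_simps)
  \<comment> \<open>As \<open>|Im (Ln w)| <= pi / 2\<close> in the half-plane, the angular part of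
    the factor with \<epsilon> is at most \<open>exp (\<delta> / 2 * |Im w|)\<close>.\<close>
  define \<epsilon> where "\<epsilon> = \<delta> / pi"
  have \<epsilon>: "\<epsilon> > 0" using \<delta> by (simp add: \<epsilon>_def)
  \<comment> \<open>The first abscissa where the cosine in \<open>norm_sin_lower_bound\<close> is
    -1, to the left of the smallest zero \<open>lam\<close> of \<open>S\<close>. That
    \<open>x0 < 1\<close> makes \<open>ln x0\<close> negative.\<close>
  define x0 where "x0 = lam / 2"
  have x0: "0 < x0" "x0 < 1" "x0 < x" using lam x by (auto simp: x0_def)
  have C: "C \<ge> 0"
    using growth[of 1] norm_ge_zero[of "E 1"] by (simp del: norm_ge_zero)
  have gb: "norm (g w) \<le> 4 * C * exp (- \<delta> * \<bar>Im w\<bar>)"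
    if w: "w \<in> U" and good: "cos (2 * (pi / lam * Re w)) = - 1 \<or> \<bar>pi / lam * Im w\<bar> \<ge> 1" for w
  proof -
    have "exp \<bar>pi / lam * Im w\<bar> / 4 \<le> norm (S w)"
      unfolding S_def using norm_sin_lower_bound[of "of_real (pi / lam) * w"] good by simp
    then have S: "exp (pi / lam * \<bar>Im w\<bar>) / 4 \<le> norm (S w)" using lam by (simp add: abs_mult)
    have "norm (g w) * (exp (pi / lam * \<bar>Im w\<bar>) / 4) \<le> norm (g w) * norm (S w)"
      by (intro mult_left_mono S) auto
    also have "\<dots> = norm (E w)" using g[OF w] by (simp add: norm_mult)
    also have "\<dots> \<le> C * exp (pi * \<bar>Im w\<bar>)" using w by (intro growth) (simp add: U_def)
    finally have "norm (g w) \<le> 4 * C * (exp (pi * \<bar>Im w\<bar>) / exp (pi / lam * \<bar>Im w\<bar>))"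
      by (simp add: field_simps)
    also have "exp (pi * \<bar>Im w\<bar>) / exp (pi / lam * \<bar>Im w\<bar>) = exp (- \<delta> * \<bar>Im w\<bar>)"
      by (simp add: exp_diff[symmetric] \<delta>_def algebra_simps)
    finally show ?thesis .
  qed
  define D where "D = 4 * C * exp (\<epsilon> * x * ln x - \<epsilon> * x0 * ln x0)"
  have key: "norm (g (of_real x)) \<le> D * exp (- K * (x - x0))" if K: "K \<ge> 0" for K
  proof -
    define h where "h = (\<lambda>w. g w * exp (of_real K * w - of_real \<epsilon> * w * Ln w))"
    \<comment> \<open>From this radius on \<open>\<epsilon> * ln |w| >= K\<close>, so that
      \<open>exp (K * Re w)\<close> is absorbed.\<close>
    define R where "R = exp (K / \<epsilon>)"
    have R: "R \<ge> 1" using K \<epsilon> by (simp add: R_def)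
    obtain N :: nat where N: "real N > (R + x) / lam" using reals_Archimedean2 by blast
    \<comment> \<open>Half-way between two consecutive zeros of \<open>S\<close>, where the cosine
      is -1 again.\<close>
    define X where "X = lam * (real N + 1 / 2)"
    have X: "X > R" "X > x"
    proof -
      have "R + x < lam * real N" using N lam by (simp add: field_simps)
      then show "X > R" "X > x" using x lam R by (auto simp: X_def algebra_simps)
    qed
    define T where "T = R + 1"
    define B where "B = cbox (Complex x0 (- T)) (Complex X T)"
    have inB: "w \<in> B \<longleftrightarrow> x0 \<le> Re w \<and> Re w \<le> X \<and> - T \<le> Im w \<and> Im w \<le> T" for w
      by (auto simp: B_def in_cbox_complex_iff)
    have BU: "B \<subseteq> U" using x0 by (auto simp: inB U_def)
    have hh: "h holomorphic_on U"
      unfolding h_def using hg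
      by (intro holomorphic_intros) (auto simp: U_def complex_nonpos_Reals_iff)
    have hb: "norm (h w) \<le> 4 * C * exp (K * Re w - \<epsilon> * Re w * ln (norm w))"
      if w: "w \<in> U" and good: "cos (2 * (pi / lam * Re w)) = - 1 \<or> \<bar>pi / lam * Im w\<bar> \<ge> 1" for w
    proof -
      have w0: "w \<noteq> 0" using w by (auto simp: U_def)
      have a: "\<bar>Im (Ln w)\<bar> \<le> pi / 2"
        using Re_Ln_pos_lt_imp[of w] w w0 by (simp add: U_def)
      have "Im w * Im (Ln w) \<le> \<bar>Im w\<bar> * (pi / 2)"
        using mult_mono[OF order_refl[of "\<bar>Im w\<bar>"] a] abs_ge_self[of "Im w * Im (Ln w)"]
        by (simp add: abs_mult)
      then have "\<epsilon> * (Im w * Im (Ln w)) \<le> \<epsilon> * (\<bar>Im w\<bar> * (pi / 2))"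
        using \<epsilon> by (intro mult_left_mono) auto
      also have "\<dots> \<le> \<delta> * \<bar>Im w\<bar>" using \<delta> by (simp add: \<epsilon>_def)
      finally have a': "\<epsilon> * (Im w * Im (Ln w)) \<le> \<delta> * \<bar>Im w\<bar>" .
      have "norm (h w) = norm (g w) * exp (K * Re w - \<epsilon> * (Re w * ln (norm w) - Im w * Im (Ln w)))"
        using w0 by (simp add: h_def norm_mult algebra_simps)
      also have "\<dots> \<le> (4 * C * exp (- \<delta> * \<bar>Im w\<bar>)) *
          exp (K * Re w - \<epsilon> * (Re w * ln (norm w) - Im w * Im (Ln w)))"
        by (intro mult_right_mono gb w good) auto
      also have "\<dots> = 4 * C * exp (- \<delta> * \<bar>Im w\<bar> + (K * Re w - \<epsilon> * (Re w * ln (norm w) - Im w * Im (Ln w))))"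
        by (simp only: exp_add mult.assoc)
      also have "\<dots> \<le> 4 * C * exp (K * Re w - \<epsilon> * Re w * ln (norm w))"
        using a' C by (intro mult_left_mono) (auto simp: algebra_simps)
      finally show ?thesis .
    qed
    \<comment> \<open>The bound on the side \<open>Re w = x0\<close>, with \<open>norm w\<close>
      replaced by its minimum \<open>x0\<close>. As \<open>ln x0 <= 0\<close> it is at least
      \<open>4 * C\<close>, which covers the other three sides.\<close>
    define M where "M = 4 * C * exp (K * x0 - \<epsilon> * x0 * ln x0)"
    have far: "norm (h w) \<le> M"
      if w: "w \<in> U" and good: "cos (2 * (pi / lam * Re w)) = - 1 \<or> \<bar>pi / lam * Im w\<bar> \<ge> 1"
        and r: "norm w \<ge> R" for w
    proof -
      have "ln (norm w) \<ge> K / \<epsilon>" using r R ln_ge_iff[of "norm w" "K / \<epsilon>"] unfolding R_def by linarith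
      then have "\<epsilon> * ln (norm w) \<ge> K" using \<epsilon> by (simp add: field_simps)
      then have "Re w * (\<epsilon> * ln (norm w)) \<ge> Re w * K"
        using w by (intro mult_left_mono) (auto simp: U_def)
      then have 1: "K * Re w - \<epsilon> * Re w * ln (norm w) \<le> 0" by (simp add: algebra_simps)
      have "\<epsilon> * (x0 * ln x0) \<le> 0" using x0 \<epsilon> by (intro mult_nonneg_nonpos) auto
      then have "K * x0 - \<epsilon> * x0 * ln x0 \<ge> 0"
        using mult_nonneg_nonneg[OF K less_imp_le[OF x0(1)]] by (simp add: mult.assoc)
      then have "4 * C * exp (K * Re w - \<epsilon> * Re w * ln (norm w)) \<le> M"
        unfolding M_def using 1 C by (intro mult_left_mono) auto
      then show ?thesis using hb[OF w good] by linarith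
    qed
    have bd: "norm (h w) \<le> M" if w: "w \<in> frontier B" for w
    proof -
      have "w \<in> B" using w by (simp add: B_def frontier_cbox)
      then have wU: "w \<in> U" using BU by auto
      have "\<not> (x0 < Re w \<and> Re w < X \<and> - T < Im w \<and> Im w < T)"
        using w by (simp add: B_def frontier_cbox in_box_complex_iff)
      then consider "Re w = x0" | "Re w = X" | "\<bar>Im w\<bar> = T"
        using \<open>w \<in> B\<close> R unfolding inB T_def by linarith
      then show ?thesis
      proof cases
        case 1
        have good: "cos (2 * (pi / lam * Re w)) = - 1" using lam by (simp add: 1 x0_def)
        have "x0 \<le> norm w"
          using complex_Re_le_cmod[of w] 1 by linarith
        then have "ln x0 \<le> ln (norm w)" using x0 by (subst ln_le_cancel_iff) linarith+
        then have "\<epsilon> * x0 * ln x0 \<le> \<epsilon> * x0 * ln (norm w)"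
          using \<epsilon> x0 by (intro mult_left_mono) auto
        then have "4 * C * exp (K * Re w - \<epsilon> * Re w * ln (norm w)) \<le> M"
          unfolding M_def 1 using C by (intro mult_left_mono) auto
        then show ?thesis using hb[OF wU] good by (meson order_trans)
      next
        case 2
        have "2 * (pi / lam * Re w) = 2 * real N * pi + pi"
          using lam by (simp add: 2 X_def field_simps)
        then have "cos (2 * (pi / lam * Re w)) = - 1"
          by (simp only: cos_periodic_pi cos_2npi)
        moreover have "R \<le> norm w"
          using complex_Re_le_cmod[of w] 2 X by linarith
        ultimately show ?thesis using far[OF wU] by blast
      next
        case 3
        have q: "1 \<le> pi / lam"
          unfolding pos_le_divide_eq[OF lam(1)] using lam pi_gt3 by linarith
        have "1 * 1 \<le> pi / lam * T"
          by (rule mult_mono) (use q R in \<open>unfold T_def, linarith+\<close>)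
        moreover have "\<bar>pi / lam * Im w\<bar> = pi / lam * T"
          unfolding abs_mult 3 using q by (subst abs_of_nonneg) linarith+
        ultimately have "\<bar>pi / lam * Im w\<bar> \<ge> 1" by linarith
        moreover have "R \<le> norm w"
          using abs_Im_le_cmod[of w] 3 unfolding T_def by linarith
        ultimately show ?thesis using far[OF wU] by blast
      qed
    qed
    have "norm (h (of_real x)) \<le> M"
    proof (rule maximum_modulus_frontier[of h B])
      show "h holomorphic_on interior B"
        by (rule holomorphic_on_subset[OF hh]) (use BU interior_subset in blast)
      show "continuous_on (closure B) h"
        using holomorphic_on_imp_continuous_on[OF holomorphic_on_subset[OF hh BU]]
        by (simp add: B_def)
      show "bounded B" by (simp add: B_def)
      show "of_real x \<in> B" using x0 X R by (simp add: inB T_def)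
    qed (rule bd)
    moreover have "norm (h (of_real x)) = norm (g (of_real x)) * exp (K * x - \<epsilon> * x * ln x)"
      using x0 by (simp add: h_def norm_mult Ln_of_real)
    ultimately have "norm (g (of_real x)) \<le> M / exp (K * x - \<epsilon> * x * ln x)"
      by (simp add: pos_le_divide_eq)
    also have "\<dots> = 4 * C * exp (K * x0 - \<epsilon> * x0 * ln x0 - (K * x - \<epsilon> * x * ln x))"
      by (simp only: M_def exp_diff times_divide_eq_right)
    also have "K * x0 - \<epsilon> * x0 * ln x0 - (K * x - \<epsilon> * x * ln x) =
        \<epsilon> * x * ln x - \<epsilon> * x0 * ln x0 + - K * (x - x0)"
      by (simp add: algebra_simps)
    also have "4 * C * exp \<dots> = D * exp (- K * (x - x0))"
      by (simp only: D_def exp_add mult.assoc)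
    finally show ?thesis .
  qed
  \<comment> \<open>The left side contributes \<open>exp (K * x0)\<close> against
    \<open>exp (K * x)\<close> at the point itself, and \<open>x0 < x\<close>.\<close>
  have "((\<lambda>K. D * exp (- K * (x - x0))) \<longlongrightarrow> 0) at_top"
    using x0(3) by real_asymp
  moreover have "\<forall>\<^sub>F K in at_top. norm (g (of_real x)) \<le> D * exp (- K * (x - x0))"
    using eventually_ge_at_top[of "0::real"] by eventually_elim (rule key)
  ultimately have "norm (g (of_real x)) \<le> 0"
    by (rule tendsto_lowerbound) simp
  then show ?thesis using g[of "of_real x"] x0 by (simp add: U_def)
qed

section \<open>Identity theorem on rays and lines, and zeros at square roots\<close>

lemma entire_eq_on_ray:
  fixes f g :: "complex \<Rightarrow> complex"
  assumes f: "f holomorphic_on UNIV" and g: "g holomorphic_on UNIV" and v: "v \<noteq> 0"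
    and eq: "\<And>x::real. x > r \<Longrightarrow> f (p + of_real x * v) = g (p + of_real x * v)"
  shows "f z = g z"
proof -
  let ?U = "(\<lambda>x::real. p + of_real x * v) ` {r<..}"
  define s where "s = (\<lambda>n::nat. p + of_real (r + 1 + inverse (real (Suc n))) * v)"
  have "s \<longlonglongrightarrow> p + of_real (r + 1 + 0) * v"
    unfolding s_def by (intro tendsto_intros LIMSEQ_inverse_real_of_nat)
  moreover have "s n \<in> ?U - {p + of_real (r + 1 + 0) * v}" for n
  proof -
    have "inverse (real (Suc n)) > 0" by simp
    then have "r + 1 + inverse (real (Suc n)) > r" by linarith
    then have "s n \<in> ?U" unfolding s_def by blast
    then show ?thesis using v by (simp add: s_def del: of_nat_Suc)
  qed
  ultimately have lim: "p + of_real (r + 1 + 0) * v islimpt ?U"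
    unfolding islimpt_sequential by blast
  have "(\<lambda>z. f z - g z) z = 0"
    by (rule analytic_continuation[where S = UNIV and U = ?U and \<xi> = "p + of_real (r + 1 + 0) * v"])
      (use lim eq f g in \<open>auto intro!: holomorphic_on_diff\<close>)
  then show ?thesis by simp
qed

lemma entire_eq_0_of_horizontal_line:
  fixes F :: "complex \<Rightarrow> complex"
  assumes "F holomorphic_on UNIV" and zero: "\<And>x. F (Complex x y) = 0"
  shows "F z = 0"
proof (rule entire_eq_on_ray[OF assms(1), of "\<lambda>_. 0" 1 0 "Complex 0 y"])
  fix x :: real
  have "Complex 0 y + of_real x * 1 = Complex x y" by (simp add: complex_eq_iff)
  then show "F (Complex 0 y + of_real x * 1) = 0" using zero by simp
qed auto

lemma entire_mult_eq_0:
  fixes f g :: "complex \<Rightarrow> complex"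
  assumes f: "f holomorphic_on UNIV" and g: "g holomorphic_on UNIV"
    and fg: "\<And>z. f z * g z = 0" and z0: "f z0 \<noteq> 0"
  shows "g z = 0"
proof -
  have "continuous (at z0) f"
    using holomorphic_on_imp_continuous_on[OF f] by (simp add: continuous_on_eq_continuous_at)
  from continuous_at_avoid[OF this z0] obtain e
    where e: "e > 0" "\<And>y. dist z0 y < e \<Longrightarrow> f y \<noteq> 0" by blast
  show ?thesis
  proof (rule analytic_continuation_open[where s = "ball z0 e" and s' = UNIV and f = g and g = "\<lambda>_. 0"])
    show "g z = 0" if "z \<in> ball z0 e" for z
      using fg[of z] e(2)[of z] that by auto
  qed (use e g in auto)
qed

text \<open>On the right half-plane
  \<open>(Im (csqrt w))^2 = (|w| - Re w) / 2 <= |Im w| / 2\<close>, which yields precisely the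
  growth that \<open>carlson_half_plane\<close> admits.\<close>

lemma entire_eq_0_of_sqrt_zeros:
  fixes K :: "complex \<Rightarrow> complex"
  assumes K: "K holomorphic_on UNIV"
    and growth: "\<And>z. norm (K z) \<le> C * exp (2 * pi * (Im z)\<^sup>2)"
    and zeros: "\<And>n::nat. K (of_real (a * sqrt (real n))) = 0"
    and a: "0 < a" "a < 1"
  shows "K z = 0"
proof (rule entire_eq_on_ray[OF K, of "\<lambda>_. 0" 1 1 0])
  define E where "E = (\<lambda>w. K (csqrt w))"
  have hE: "E holomorphic_on {w. Re w > 0}"
    unfolding E_def
    by (rule holomorphic_on_compose_gen[OF _ K, unfolded o_def])
      (auto intro!: holomorphic_intros simp: complex_nonpos_Reals_iff)
  have C: "C \<ge> 0" using growth[of 0] norm_ge_zero[of "K 0"] by (simp del: norm_ge_zero)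
  have gr: "norm (E w) \<le> C * exp (pi * \<bar>Im w\<bar>)" if w: "Re w > 0" for w
  proof -
    have "(Im (csqrt w))\<^sup>2 = (norm w - Re w) / 2"
      using complex_Re_le_cmod[of w] by (simp add: power_mult_distrib sgn_if)
    also have "\<dots> \<le> \<bar>Im w\<bar> / 2" using cmod_le[of w] w by simp
    finally have "2 * pi * (Im (csqrt w))\<^sup>2 \<le> pi * \<bar>Im w\<bar>" by simp
    then have "C * exp (2 * pi * (Im (csqrt w))\<^sup>2) \<le> C * exp (pi * \<bar>Im w\<bar>)"
      using C by (intro mult_left_mono) auto
    then show ?thesis unfolding E_def using growth[of "csqrt w"] by linarith
  qed
  have zE: "E (of_real (a\<^sup>2 * real n)) = 0" for n
    using zeros[of n] a by (simp add: E_def real_sqrt_mult del: of_real_mult of_real_power)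
  have a2: "0 < a\<^sup>2" "a\<^sup>2 < 1" using a by (auto simp: power_less_one_iff)
  fix x :: real assume x: "x > 1"
  then have "x\<^sup>2 > 1" by (simp add: one_less_power)
  then have "E (of_real (x\<^sup>2)) = 0"
    by (intro carlson_half_plane[OF hE gr zE a2]) (use a2 in auto)
  then show "K (0 + of_real x * 1) = 0"
    using x by (simp add: E_def del: of_real_power)
qed auto

section \<open>Entire functions with equal moduli on lines and lattices\<close>

text \<open>On the real axis \<open>F z * conj_refl F z\<close> equals \<open>|F z|^2\<close>, so an
  equality of moduli becomes an equality of entire functions.\<close>

definition conj_refl :: "(complex \<Rightarrow> complex) \<Rightarrow> complex \<Rightarrow> complex" where
  "conj_refl F z = cnj (F (cnj z))"

lemma holomorphic_conj_refl:
  assumes "F holomorphic_on UNIV"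
  shows "conj_refl F holomorphic_on UNIV"
proof -
  have "range cnj = UNIV" by (metis complex_cnj_cnj surjI)
  then have "(cnj \<circ> F \<circ> cnj) holomorphic_on UNIV"
    using assms by (intro holomorphic_on_compose_cnj_cnj) simp_all
  then show ?thesis by (simp add: conj_refl_def[abs_def] o_def)
qed

lemma mult_cnj_norm_eq_iff: "z * cnj z = w * cnj w \<longleftrightarrow> norm z = norm w"
  unfolding complex_norm_square[symmetric] of_real_eq_iff by (simp add: power2_eq_iff_nonneg)

text \<open>The conclusion says that \<open>F1 / F2\<close> is constant, in a form that tolerates
  zeros.\<close>

lemma entire_proportional_of_modulus_eq_on_lines:
  fixes F1 F2 :: "complex \<Rightarrow> complex"
  assumes F1: "F1 holomorphic_on UNIV" and F2: "F2 holomorphic_on UNIV"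
    and Y: "\<And>e. e > 0 \<Longrightarrow> \<exists>y\<in>Y. \<exists>y'\<in>Y. y \<noteq> y' \<and> \<bar>y - y'\<bar> < e"
    and eq: "\<And>x y::real. y \<in> Y \<Longrightarrow> norm (F1 (Complex x y)) = norm (F2 (Complex x y))"
  shows "F1 w * F2 u = F2 w * F1 u"
proof -
  let ?G1 = "conj_refl F1" and ?G2 = "conj_refl F2"
  have G: "?G1 holomorphic_on UNIV" "?G2 holomorphic_on UNIV" using F1 F2 by (auto intro: holomorphic_conj_refl)
  have comp: "(\<lambda>z. g (z - c)) holomorphic_on UNIV" if "g holomorphic_on UNIV" for g and c :: complex
    by (rule holomorphic_on_compose_gen[OF _ that, unfolded o_def]) (auto intro!: holomorphic_intros)
  \<comment> \<open>Reflection in the line \<open>Im z = y\<close> maps \<open>z\<close> to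
    \<open>cnj z + 2 i y\<close>; on this line the two sides are \<open>|F1 z|^2\<close> and
    \<open>|F2 z|^2\<close>.\<close>
  have mirror: "F1 z * ?G1 (z - 2 * \<i> * of_real y) = F2 z * ?G2 (z - 2 * \<i> * of_real y)"
    if y: "y \<in> Y" for y z
  proof (rule entire_eq_on_ray[where f = "\<lambda>z. F1 z * ?G1 (z - 2 * \<i> * of_real y)"
        and g = "\<lambda>z. F2 z * ?G2 (z - 2 * \<i> * of_real y)" and p = "\<i> * of_real y" and v = 1 and r = 0])
    show "(\<lambda>z. F1 z * ?G1 (z - 2 * \<i> * of_real y)) holomorphic_on UNIV"
      "(\<lambda>z. F2 z * ?G2 (z - 2 * \<i> * of_real y)) holomorphic_on UNIV"
      by (intro holomorphic_on_mult F1 F2 comp G)+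
    fix x :: real
    have 1: "\<i> * of_real y + of_real x * 1 = Complex x y" by (simp add: complex_eq_iff)
    have 2: "cnj (Complex x y - 2 * \<i> * of_real y) = Complex x y" by (simp add: complex_eq_iff)
    show "F1 (\<i> * of_real y + of_real x * 1) * ?G1 (\<i> * of_real y + of_real x * 1 - 2 * \<i> * of_real y) =
        F2 (\<i> * of_real y + of_real x * 1) * ?G2 (\<i> * of_real y + of_real x * 1 - 2 * \<i> * of_real y)"
      unfolding 1 conj_refl_def 2 mult_cnj_norm_eq_iff by (rule eq[OF y])
  qed simp
  obtain y0 where y0: "y0 \<in> Y" using Y[of 1] by auto
  have swap: "G w = 0" if "F z1 \<noteq> 0" "F holomorphic_on UNIV" "G holomorphic_on UNIV"
    "\<And>z. F z = 0 \<or> G z = 0" for F G :: "complex \<Rightarrow> complex" and z1 w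
    by (rule entire_mult_eq_0[OF that(2,3) _ that(1)]) (use that(4) in auto)
  show ?thesis
  proof (cases "(\<forall>z. F1 z = 0) \<or> (\<forall>z. F2 z = 0)")
    case True
    then have "(\<forall>z. F1 z = 0) \<and> (\<forall>z. F2 z = 0)"
      using entire_eq_0_of_horizontal_line[OF F1, of y0] entire_eq_0_of_horizontal_line[OF F2, of y0] eq[OF y0]
      by (metis norm_eq_zero)
    then show ?thesis by simp
  next
    case False
    then obtain z1 z2 where z1: "F1 z1 \<noteq> 0" and z2: "F2 z2 \<noteq> 0" by blast
    have "\<exists>z. F1 z * F2 z \<noteq> 0"
      using swap[OF z1 F1 F2] z2 by (metis mult_eq_0_iff)
    then obtain z3 where z3: "F1 z3 * F2 z3 \<noteq> 0" by blast
    \<comment> \<open>Cross-multiplying \<open>mirror\<close> for \<open>y\<close> and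
      \<open>y'\<close> produces the common factor \<open>F1 z * F2 z\<close>, which cancels because
      it is not identically zero.\<close>
    have period: "?G1 z * ?G2 (z - 2 * \<i> * of_real (y' - y)) = ?G2 z * ?G1 (z - 2 * \<i> * of_real (y' - y))"
      if y: "y \<in> Y" "y' \<in> Y" for y y' z
    proof -
      let ?D = "\<lambda>z. ?G1 (z - 2 * \<i> * of_real y) * ?G2 (z - 2 * \<i> * of_real y')
          - ?G2 (z - 2 * \<i> * of_real y) * ?G1 (z - 2 * \<i> * of_real y')"
      have "?D (z + 2 * \<i> * of_real y) = 0"
      proof (rule entire_mult_eq_0[where f = "\<lambda>z. F1 z * F2 z" and g = ?D])
        show "(\<lambda>z. F1 z * F2 z) holomorphic_on UNIV" "?D holomorphic_on UNIV"
          by (intro holomorphic_on_mult holomorphic_on_diff F1 F2 comp G)+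
        show "F1 z3 * F2 z3 \<noteq> 0" by (rule z3)
        fix z
        have "F1 z * F2 z * ?D z =
          (F1 z * ?G1 (z - 2 * \<i> * of_real y)) * (F2 z * ?G2 (z - 2 * \<i> * of_real y')) -
          (F2 z * ?G2 (z - 2 * \<i> * of_real y)) * (F1 z * ?G1 (z - 2 * \<i> * of_real y'))"
          by (simp only: right_diff_distrib ac_simps)
        then show "F1 z * F2 z * ?D z = 0"
          unfolding mirror[OF y(1)] mirror[OF y(2)] by simp
      qed
      then show ?thesis by (simp add: algebra_simps)
    qed
    \<comment> \<open>For fixed \<open>z\<close> the identity holds at \<open>u = z\<close> shifted
      by any of the periods, and these points accumulate at \<open>z\<close>.\<close>
    have ratio: "?G1 z * ?G2 u = ?G2 z * ?G1 u" for z u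
    proof -
      let ?D = "\<lambda>u. ?G1 z * ?G2 u - ?G2 z * ?G1 u"
      let ?U = "{u. \<exists>y\<in>Y. \<exists>y'\<in>Y. y \<noteq> y' \<and> u = z - 2 * \<i> * of_real (y' - y)}"
      have "?D u = 0"
      proof (rule analytic_continuation[where f = ?D and S = UNIV and U = ?U and \<xi> = z])
        show "?D holomorphic_on UNIV" by (intro holomorphic_on_diff holomorphic_on_mult holomorphic_on_const G)
        show "?D u = 0" if "u \<in> ?U" for u using that period by auto
        show "z islimpt ?U"
          unfolding islimpt_approachable
        proof (intro allI impI)
          fix e :: real assume "e > 0"
          with Y[of "e / 2"] obtain y y' where y: "y \<in> Y" "y' \<in> Y" "y \<noteq> y'" "\<bar>y - y'\<bar> < e / 2" by auto
          have "dist (z - 2 * \<i> * of_real (y' - y)) z = 2 * \<bar>y' - y\<bar>"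
            by (simp only: dist_norm) (simp add: norm_mult flip: of_real_diff)
          then show "\<exists>x'\<in>?U. x' \<noteq> z \<and> dist x' z < e"
            using y by (intro bexI[of _ "z - 2 * \<i> * of_real (y' - y)"]) (auto simp: abs_minus_commute)
        qed
      qed auto
      then show ?thesis by simp
    qed
    have "cnj (F1 w * F2 u) = cnj (F2 w * F1 u)"
      using ratio[of "cnj w" "cnj u"] by (simp add: conj_refl_def)
    then show ?thesis by (simp only: complex_cnj_cancel_iff)
  qed
qed

text \<open>The modulus of the constant ratio is read off at a point of one line where
  \<open>F1\<close> is nonzero; if there is none, both functions vanish identically.\<close>

lemma norm_eq_of_modulus_eq_on_lines:
  fixes F1 F2 :: "complex \<Rightarrow> complex"
  assumes F1: "F1 holomorphic_on UNIV" and F2: "F2 holomorphic_on UNIV"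
    and Y: "\<And>e. e > 0 \<Longrightarrow> \<exists>y\<in>Y. \<exists>y'\<in>Y. y \<noteq> y' \<and> \<bar>y - y'\<bar> < e"
    and eq: "\<And>x y::real. y \<in> Y \<Longrightarrow> norm (F1 (Complex x y)) = norm (F2 (Complex x y))"
  shows "norm (F1 z) = norm (F2 z)"
proof -
  obtain y0 where y0: "y0 \<in> Y" using Y[of 1] by auto
  have ratio: "F1 w * F2 u = F2 w * F1 u" for w u
    by (rule entire_proportional_of_modulus_eq_on_lines[OF F1 F2 Y eq])
  show ?thesis
  proof (cases "\<exists>x. F1 (Complex x y0) \<noteq> 0")
    case True
    then obtain x where x: "F1 (Complex x y0) \<noteq> 0" by blast
    have "norm (F1 (Complex x y0)) * norm (F2 z) = norm (F2 (Complex x y0)) * norm (F1 z)"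
      using arg_cong[OF ratio[of "Complex x y0" z], of norm] by (simp add: norm_mult)
    then have "norm (F1 (Complex x y0)) * norm (F2 z) = norm (F1 (Complex x y0)) * norm (F1 z)"
      by (simp only: eq[OF y0])
    then show ?thesis using x by simp
  next
    case False
    then have z: "F1 (Complex x y0) = 0" "F2 (Complex x y0) = 0" for x
      using eq[OF y0, of x] by auto
    show ?thesis
      using entire_eq_0_of_horizontal_line[OF F1 z(1)] entire_eq_0_of_horizontal_line[OF F2 z(2)] by simp
  qed
qed

section \<open>From the square-root lattice to lines and to the plane\<close>

lemma sqrt_of_nat_in_sqrt_ints: "sqrt (real n) \<in> sqrt_ints"
  unfolding sqrt_ints_def by (auto intro!: exI[of _ "int n"])

text \<open>The product of \<open>G\<close> with its reflection doubles the exponent, which is the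
  origin of the \<open>2 * pi\<close> in \<open>entire_eq_0_of_sqrt_zeros\<close>.\<close>

lemma modulus_eq_on_real_line:
  fixes G1 G2 :: "complex \<Rightarrow> complex"
  assumes G1: "G1 holomorphic_on UNIV" and G2: "G2 holomorphic_on UNIV"
    and growth: "\<And>z. norm (G1 z) \<le> C * exp (pi * (Im z)\<^sup>2)" "\<And>z. norm (G2 z) \<le> C * exp (pi * (Im z)\<^sup>2)"
    and a: "0 < a" "a < 1"
    and eq: "\<And>s. s \<in> sqrt_ints \<Longrightarrow> norm (G1 (of_real (a * s))) = norm (G2 (of_real (a * s)))"
  shows "norm (G1 (of_real x)) = norm (G2 (of_real x))"
proof -
  define K where "K = (\<lambda>z. G1 z * conj_refl G1 z - G2 z * conj_refl G2 z)"
  have K_real: "K (of_real t) = 0 \<longleftrightarrow> norm (G1 (of_real t)) = norm (G2 (of_real t))" for t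
    by (simp add: K_def conj_refl_def mult_cnj_norm_eq_iff del: complex_mult_cnj)
  have "K (of_real x) = 0"
  proof (rule entire_eq_0_of_sqrt_zeros[where K = K, OF _ _ _ a])
    show "K holomorphic_on UNIV"
      unfolding K_def by (intro holomorphic_on_diff holomorphic_on_mult G1 G2 holomorphic_conj_refl)
    show "norm (K z) \<le> 2 * C\<^sup>2 * exp (2 * pi * (Im z)\<^sup>2)" for z
    proof -
      have "norm (G z * conj_refl G z) \<le> C\<^sup>2 * exp (2 * pi * (Im z)\<^sup>2)"
        if g: "\<And>z. norm (G z) \<le> C * exp (pi * (Im z)\<^sup>2)" for G
      proof -
        have "norm (G z * conj_refl G z) \<le> (C * exp (pi * (Im z)\<^sup>2)) * (C * exp (pi * (Im z)\<^sup>2))"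
          unfolding norm_mult using g[of z] g[of "cnj z"]
          by (intro mult_mono') (simp_all add: conj_refl_def)
        also have "\<dots> = C\<^sup>2 * exp (2 * pi * (Im z)\<^sup>2)"
          by (simp add: power2_eq_square mult_exp_exp)
        finally show ?thesis .
      qed
      from this[OF growth(1)] this[OF growth(2)] show ?thesis
        unfolding K_def using norm_triangle_ineq4[of "G1 z * conj_refl G1 z" "G2 z * conj_refl G2 z"]
        by linarith
    qed
    show "K (of_real (a * sqrt (real n))) = 0" for n
    proof -
      from eq[OF sqrt_of_nat_in_sqrt_ints] show ?thesis by (simp only: K_real)
    qed
  qed
  then show ?thesis by (simp only: K_real)
qed

text \<open>The gap \<open>sqrt (n + 1) - sqrt n\<close> is at most
  \<open>1 / sqrt n\<close>.\<close>

lemma sqrt_ints_arbitrarily_close: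
  assumes c: "c > 0" and e: "e > 0"
  shows "\<exists>y\<in>(\<lambda>s. c * s) ` sqrt_ints. \<exists>y'\<in>(\<lambda>s. c * s) ` sqrt_ints. y \<noteq> y' \<and> \<bar>y - y'\<bar> < e"
proof -
  obtain n :: nat where n: "real n > (c / e)\<^sup>2" using reals_Archimedean2 by blast
  define p q where "p = sqrt (real (Suc n))" and "q = sqrt (real n)"
  have pq: "p\<^sup>2 - q\<^sup>2 = 1" "q \<ge> 0" "p > q" by (simp_all add: p_def q_def)
  have "q > c / e" unfolding q_def using n c e by (intro real_less_rsqrt) auto
  then have ce: "c < e * q" using e by (simp add: field_simps)
  have "(p - q) * q \<le> (p - q) * (p + q)" using pq by (intro mult_left_mono) auto
  also have "\<dots> = 1" using pq(1) by (simp add: power2_eq_square algebra_simps)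
  finally have "(p - q) * q \<le> 1" .
  then have "(p - q) * c < e"
  proof -
    have "(p - q) * c < (p - q) * (e * q)" using ce pq by (intro mult_strict_left_mono) auto
    also have "\<dots> = e * ((p - q) * q)" by simp
    also have "\<dots> \<le> e * 1" using \<open>(p - q) * q \<le> 1\<close> e by (intro mult_left_mono) auto
    finally show ?thesis by simp
  qed
  moreover have "\<bar>c * p - c * q\<bar> = (p - q) * c"
    unfolding right_diff_distrib[symmetric] abs_mult using pq c by simp
  moreover have "p \<in> sqrt_ints" "q \<in> sqrt_ints"
    unfolding p_def q_def by (rule sqrt_of_nat_in_sqrt_ints)+
  ultimately show ?thesis
    using pq c by (intro bexI[of _ "c * p"] bexI[of _ "c * q"]) auto
qed

text \<open>The direction with constant below 1 is filled by Carlson's theorem; the other one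
  supplies the parallel lines, for which every positive constant is good enough.\<close>

lemma modulus_eq_of_sqrt_lattice:
  fixes F1 F2 :: "complex \<Rightarrow> complex"
  assumes F: "F1 holomorphic_on UNIV" "F2 holomorphic_on UNIV"
    and growth: "\<And>z. norm (F1 z) \<le> C * exp (pi * (Re z)\<^sup>2)" "\<And>z. norm (F2 z) \<le> C * exp (pi * (Re z)\<^sup>2)"
    and ab: "0 < a" "0 < b" "min a b < 1"
    and eq: "\<And>s r. s \<in> sqrt_ints \<Longrightarrow> r \<in> sqrt_ints \<Longrightarrow>
      norm (F1 (Complex (a * s) (b * r))) = norm (F2 (Complex (a * s) (b * r)))"
  shows "norm (F1 z) = norm (F2 z)"
proof -
  have C: "C \<ge> 0" using growth(1)[of 0] norm_ge_zero[of "F1 0"] by (simp del: norm_ge_zero)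
  have comp: "(\<lambda>z. F (c * z + d)) holomorphic_on UNIV" if "F holomorphic_on UNIV" for F and c d :: complex
    by (rule holomorphic_on_compose_gen[OF _ that, unfolded o_def]) (auto intro!: holomorphic_intros)
  show ?thesis
  proof (cases "a < 1")
    case True
    show ?thesis
    proof (rule norm_eq_of_modulus_eq_on_lines[OF F sqrt_ints_arbitrarily_close[OF ab(2)]])
      fix x y assume "y \<in> (\<lambda>s. b * s) ` sqrt_ints"
      then obtain r where r: "r \<in> sqrt_ints" and y: "y = b * r" by blast
      \<comment> \<open>The factor is common to both functions and has no zeros. Since
        \<open>|exp (- pi z^2)| = exp (pi ((Im z)^2 - (Re z)^2))\<close>, it trades growth in
        \<open>Re z\<close> for growth in \<open>Im z\<close>.\<close>
      define G where "G = (\<lambda>F z. F (1 * z + \<i> * of_real y) * exp (- of_real pi * z\<^sup>2))"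
      have pt: "1 * of_real t + \<i> * of_real y = Complex t y" for t by (simp add: complex_eq_iff)
      have nG: "norm (G F z) = norm (F (1 * z + \<i> * of_real y)) * exp (pi * ((Im z)\<^sup>2 - (Re z)\<^sup>2))" for F z
        unfolding G_def by (simp add: norm_mult power2_eq_square algebra_simps)
      have gr: "norm (G F z) \<le> C * exp (pi * (Im z)\<^sup>2)"
        if "\<And>z. norm (F z) \<le> C * exp (pi * (Re z)\<^sup>2)" for F z
      proof -
        have "norm (G F z) \<le> (C * exp (pi * (Re z)\<^sup>2)) * exp (pi * ((Im z)\<^sup>2 - (Re z)\<^sup>2))"
          unfolding nG using that[of "1 * z + \<i> * of_real y"] by (intro mult_right_mono) auto
        also have "\<dots> = C * exp (pi * (Im z)\<^sup>2)"
          by (simp add: mult_exp_exp algebra_simps)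
        finally show ?thesis .
      qed
      have "norm (G F1 (of_real x)) = norm (G F2 (of_real x))"
      proof (rule modulus_eq_on_real_line[where ?G1.0 = "G F1" and ?G2.0 = "G F2", OF _ _ gr gr ab(1) True])
        show "G F1 holomorphic_on UNIV" "G F2 holomorphic_on UNIV"
          unfolding G_def by (intro holomorphic_on_mult comp[OF F(1)] comp[OF F(2)] holomorphic_intros)+
        fix s assume "s \<in> sqrt_ints"
        then show "norm (G F1 (of_real (a * s))) = norm (G F2 (of_real (a * s)))"
          unfolding nG pt using eq[OF _ r] by (simp add: y)
      qed (use growth in auto)
      then show "norm (F1 (Complex x y)) = norm (F2 (Complex x y))"
        unfolding nG pt by simp
    qed
  next
    case False
    then have b1: "b < 1" using ab by auto
    \<comment> \<open>A quarter turn makes the lines \<open>Re z = a * s\<close> horizontal.\<close>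
    define F' where "F' = (\<lambda>(F::complex \<Rightarrow> complex) z. F (- \<i> * z + 0))"
    have "norm (F' F1 (\<i> * z)) = norm (F' F2 (\<i> * z))"
    proof (rule norm_eq_of_modulus_eq_on_lines[where ?F1.0 = "F' F1" and ?F2.0 = "F' F2", OF _ _ sqrt_ints_arbitrarily_close[OF ab(1)]])
      show "F' F1 holomorphic_on UNIV" "F' F2 holomorphic_on UNIV"
        unfolding F'_def by (intro comp F)+
      fix x0 x assume "x \<in> (\<lambda>s. a * s) ` sqrt_ints"
      then obtain s where s: "s \<in> sqrt_ints" and x: "x = a * s" by blast
      \<comment> \<open>The growth exponent is now \<open>(x - Im z)^2\<close>; the exponential
        cancels its term linear in \<open>Im z\<close> and has modulus 1 on the real axis.\<close>
      define G where "G = (\<lambda>F z. F (\<i> * z + of_real x) * exp (- 2 * of_real pi * \<i> * of_real x * z))"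
      have pt: "\<i> * of_real t + of_real x = Complex x t" for t by (simp add: complex_eq_iff)
      have nG: "norm (G F z) = norm (F (\<i> * z + of_real x)) * exp (2 * pi * x * Im z)" for F z
        unfolding G_def by (simp add: norm_mult)
      have gr: "norm (G F z) \<le> (C * exp (pi * x\<^sup>2)) * exp (pi * (Im z)\<^sup>2)"
        if "\<And>z. norm (F z) \<le> C * exp (pi * (Re z)\<^sup>2)" for F z
      proof -
        have "norm (G F z) \<le> (C * exp (pi * (x - Im z)\<^sup>2)) * exp (2 * pi * x * Im z)"
          unfolding nG using that[of "\<i> * z + of_real x"] by (intro mult_right_mono) auto
        also have "\<dots> = (C * exp (pi * x\<^sup>2)) * exp (pi * (Im z)\<^sup>2)"
          by (simp add: mult_exp_exp power2_eq_square algebra_simps)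
        finally show ?thesis .
      qed
      have "norm (G F1 (of_real (- x0))) = norm (G F2 (of_real (- x0)))"
      proof (rule modulus_eq_on_real_line[where ?G1.0 = "G F1" and ?G2.0 = "G F2", OF _ _ gr gr ab(2) b1])
        show "G F1 holomorphic_on UNIV" "G F2 holomorphic_on UNIV"
          unfolding G_def by (intro holomorphic_on_mult comp[OF F(1)] comp[OF F(2)] holomorphic_intros)+
        fix r assume "r \<in> sqrt_ints"
        then show "norm (G F1 (of_real (b * r))) = norm (G F2 (of_real (b * r)))"
          unfolding nG pt using eq[OF s] by (simp add: x)
      qed (use growth in auto)
      moreover have "- \<i> * Complex x0 x + 0 = Complex x (- x0)" by (simp add: complex_eq_iff)
      ultimately show "norm (F' F1 (Complex x0 x)) = norm (F' F2 (Complex x0 x))"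
        unfolding nG pt F'_def by simp
    qed
    then show ?thesis by (simp add: F'_def)
  qed
qed

section \<open>Extension one coordinate at a time\<close>

definition vec_upd :: "'a ^ 'n \<Rightarrow> 'n \<Rightarrow> 'a \<Rightarrow> 'a ^ 'n" where
  "vec_upd z l c = (\<chi> k. if k = l then c else z $ k)"

lemma vec_upd_nth: "vec_upd z l c $ k = (if k = l then c else z $ k)"
  by (simp add: vec_upd_def)

text \<open>Induction on the set of coordinates that are already arbitrary. It serves twice: for
  moduli, with lattice points as \<open>A l\<close>, and for Gaussian integrals, with a real line
  through 0 in the complex plane as \<open>A l\<close>.\<close>

lemma coordinate_extension:
  fixes P :: "'a ^ 'n \<Rightarrow> bool" and A :: "'n \<Rightarrow> 'a set"
  assumes base: "\<And>z. (\<And>l. z $ l \<in> A l) \<Longrightarrow> P z"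
    and extend: "\<And>z l. (\<And>c. c \<in> A l \<Longrightarrow> P (vec_upd z l c)) \<Longrightarrow> P z"
  shows "P z"
proof -
  have "\<forall>z. (\<forall>l. l \<notin> S \<longrightarrow> z $ l \<in> A l) \<longrightarrow> P z" if "finite S" for S
    using that
  proof (induction S)
    case empty
    then show ?case using base by simp
  next
    case (insert j S)
    show ?case
    proof (intro allI impI)
      fix z :: "'a ^ 'n" assume z: "\<forall>l. l \<notin> insert j S \<longrightarrow> z $ l \<in> A l"
      show "P z"
      proof (rule extend[of j])
        fix c assume "c \<in> A j"
        with z have "\<forall>l. l \<notin> S \<longrightarrow> vec_upd z j c $ l \<in> A l" by (auto simp: vec_upd_nth)
        with insert.IH show "P (vec_upd z j c)" by blast
      qed
    qed
  qed
  from this[of UNIV] show ?thesis by simp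
qed

section \<open>Integrals of Gaussians and exponentials\<close>

lemma sigma_finite_lebesgue: "sigma_finite_measure (lebesgue :: 'a::euclidean_space measure)"
proof
  obtain A :: "'a set set" where A: "countable A" "A \<subseteq> sets lborel" "\<Union>A = space lborel"
    "\<forall>a\<in>A. emeasure lborel a \<noteq> \<infinity>"
    using lborel.sigma_finite_countable by blast
  then show "\<exists>A::'a set set. countable A \<and> A \<subseteq> sets lebesgue \<and> \<Union>A = space lebesgue \<and> (\<forall>a\<in>A. emeasure lebesgue a \<noteq> \<infinity>)"
    by (intro exI[of _ A]) (auto simp: subset_eq)
qed

lemma continuous_imp_lebesgue_measurable:
  fixes g :: "'a::euclidean_space \<Rightarrow> 'b::{second_countable_topology, real_normed_vector}"
  assumes "continuous_on UNIV g"
  shows "g \<in> borel_measurable lebesgue"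
  using assms by (intro measurable_completion) (simp add: borel_measurable_continuous_onI)

lemma integrable_gaussian_real:
  assumes c: "c > 0"
  shows "integrable lborel (\<lambda>t::real. exp (- c * t\<^sup>2))"
proof -
  have "integrable lborel (\<lambda>t. sqrt (2 * pi * (sqrt (1 / (2 * c)))\<^sup>2) * normal_density 0 (sqrt (1 / (2 * c))) t)"
    by (intro integrable_mult_right integrable_normal_density) (use c in auto)
  then show ?thesis
    using c by (simp add: normal_density_def field_simps)
qed

lemma integrable_gaussian:
  assumes c: "c > 0"
  shows "integrable lebesgue (\<lambda>x::'a::euclidean_space. exp (- c * (norm x)\<^sup>2))"
proof -
  have meas: "(\<lambda>x::'a. exp (- c * (norm x)\<^sup>2)) \<in> borel_measurable lborel"
    by simp
  have eq: "exp (- c * (norm x)\<^sup>2) = (\<Prod>b\<in>Basis. exp (- c * (x \<bullet> b)\<^sup>2))" for x :: 'a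
    unfolding power2_norm_eq_inner by (subst euclidean_inner) (simp add: exp_sum sum_distrib_left power2_eq_square flip: sum_negf)
  define I where "I = (LINT t|lborel. exp (- c * t\<^sup>2))"
  have I: "I \<ge> 0" unfolding I_def by simp
  have "(\<integral>\<^sup>+x. ennreal (norm (exp (- c * (norm (x::'a))\<^sup>2))) \<partial>lborel) =
      (\<integral>\<^sup>+x. (\<Prod>b\<in>Basis. ennreal (exp (- c * ((x::'a) \<bullet> b)\<^sup>2))) \<partial>lborel)"
    by (simp only: eq real_norm_def prod_ennreal exp_ge_zero abs_of_nonneg prod_nonneg)
  also have "\<dots> = (\<Prod>b\<in>(Basis::'a set). (\<integral>\<^sup>+t. ennreal (exp (- c * t\<^sup>2)) \<partial>lborel))"
    by (subst nn_integral_lborel_prod) auto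
  also have "(\<integral>\<^sup>+t. ennreal (exp (- c * t\<^sup>2)) \<partial>lborel) = ennreal I"
    unfolding I_def by (rule nn_integral_eq_integral[OF integrable_gaussian_real[OF c]]) simp
  also have "(\<Prod>b\<in>(Basis::'a set). ennreal I) = ennreal (\<Prod>b\<in>(Basis::'a set). I)"
    by (rule prod_ennreal) (rule I)
  also have "\<dots> < \<infinity>" by simp
  finally have "integrable lborel (\<lambda>x::'a. exp (- c * (norm x)\<^sup>2))"
    using meas by (intro integrableI_bounded)
  then show ?thesis using integrable_completion[OF meas] by simp
qed

lemma lebesgue_integral_translate:
  fixes g :: "'a::euclidean_space \<Rightarrow> 'b::{banach, second_countable_topology}"
  assumes "continuous_on UNIV g"
  shows "(LINT x|lebesgue. g (c + x)) = (LINT x|lebesgue. g x)"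
proof -
  have g: "g \<in> borel_measurable borel" using assms by (rule borel_measurable_continuous_onI)
  have "(LINT x|lborel. g x) = (LINT x|distr lborel borel ((+) c). g x)"
    by (simp add: lborel_distr_plus)
  also have "\<dots> = (LINT x|lborel. g (c + x))"
    using g by (subst integral_distr) auto
  finally show ?thesis
    using g by (subst (1 2) integral_completion) auto
qed

lemma norm_exp_minus_1_le: "norm (exp w - 1) \<le> norm w * exp (norm w)" for w :: complex
proof -
  have "norm (exp w - 1) \<le> exp \<bar>Re w\<bar> * norm w" using Taylor_exp[of w 0] by simp
  also have "\<dots> \<le> exp (norm w) * norm w"
    using abs_Re_le_cmod[of w] by (intro mult_right_mono) auto
  finally show ?thesis by (simp add: mult.commute)
qed

text \<open>Differentiation under the integral sign, by dominated convergence along sequences of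
  increments.\<close>

lemma holomorphic_integral_exp:
  fixes g \<beta> :: "'a \<Rightarrow> complex"
  assumes [measurable]: "g \<in> borel_measurable M" "\<beta> \<in> borel_measurable M"
    and int: "\<And>r. r \<ge> 0 \<Longrightarrow> integrable M (\<lambda>x. norm (g x) * exp (r * norm (\<beta> x)))"
  shows "(\<lambda>c. LINT x|M. g x * exp (c * \<beta> x)) holomorphic_on UNIV"
proof -
  define F where "F = (\<lambda>c. LINT x|M. g x * exp (c * \<beta> x))"
  have int_F: "integrable M (\<lambda>x. g x * exp (c * \<beta> x))" for c
  proof (rule Bochner_Integration.integrable_bound[OF int[of "norm c"]])
    show "AE x in M. norm (g x * exp (c * \<beta> x)) \<le> norm (norm (g x) * exp (norm c * norm (\<beta> x)))"
    proof (rule AE_I2)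
      fix x
      have "Re (c * \<beta> x) \<le> norm c * norm (\<beta> x)"
        using complex_Re_le_cmod[of "c * \<beta> x"] by (simp only: norm_mult)
      then show "norm (g x * exp (c * \<beta> x)) \<le> norm (norm (g x) * exp (norm c * norm (\<beta> x)))"
        by (simp add: norm_mult mult_left_mono)
    qed
  qed auto
  have "(F has_field_derivative (LINT x|M. g x * exp (c * \<beta> x) * \<beta> x)) (at c)" for c
    unfolding DERIV_def tendsto_at_iff_sequentially
  proof (intro allI impI)
    fix X :: "nat \<Rightarrow> complex"
    assume X0: "\<forall>i. X i \<in> UNIV - {0}" and X: "X \<longlonglongrightarrow> 0"
    \<comment> \<open>A bound on all increments makes the majorant independent of \<open>i\<close>.
      The additional 1 in its exponent pays for the factor
      \<open>norm (\<beta> x) <= exp (norm (\<beta> x))\<close>.\<close>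
    obtain B where B: "\<And>i. norm (X i) \<le> B"
      using convergent_imp_Bseq[OF convergentI[OF X]] by (auto simp: Bseq_def)
    have B0: "B \<ge> 0" using order_trans[OF norm_ge_zero B] .
    have "(\<lambda>i. LINT x|M. g x * exp (c * \<beta> x) * ((exp (X i * \<beta> x) - 1) / X i)) \<longlonglongrightarrow>
        (LINT x|M. g x * exp (c * \<beta> x) * \<beta> x)"
    proof (rule integral_dominated_convergence)
      show "integrable M (\<lambda>x. norm (g x) * exp ((norm c + B + 1) * norm (\<beta> x)))"
        by (rule int) (use B0 in auto)
      show "AE x in M. (\<lambda>i. g x * exp (c * \<beta> x) * ((exp (X i * \<beta> x) - 1) / X i)) \<longlonglongrightarrow> g x * exp (c * \<beta> x) * \<beta> x"
      proof (rule AE_I2, rule tendsto_mult[OF tendsto_const])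
        fix x
        have "((\<lambda>t. exp (t * \<beta> x)) has_field_derivative \<beta> x) (at 0)"
          by (auto intro!: derivative_eq_intros)
        then have "(\<lambda>h. (exp (h * \<beta> x) - 1) / h) \<midarrow>0\<rightarrow> \<beta> x"
          by (simp add: DERIV_def)
        then show "(\<lambda>i. (exp (X i * \<beta> x) - 1) / X i) \<longlonglongrightarrow> \<beta> x"
          unfolding tendsto_at_iff_sequentially using X0 X by (auto simp: o_def)
      qed
      show "AE x in M. norm (g x * exp (c * \<beta> x) * ((exp (X i * \<beta> x) - 1) / X i))
          \<le> norm (g x) * exp ((norm c + B + 1) * norm (\<beta> x))" for i
      proof (rule AE_I2)
        fix x
        let ?b = "norm (\<beta> x)"
        have "Re (c * \<beta> x) \<le> norm c * ?b"
          using complex_Re_le_cmod[of "c * \<beta> x"] by (simp only: norm_mult)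
        then have 1: "norm (exp (c * \<beta> x)) \<le> exp (norm c * ?b)" by simp
        have "norm (exp (X i * \<beta> x) - 1) \<le> (norm (X i) * ?b) * exp (norm (X i) * ?b)"
          using norm_exp_minus_1_le[of "X i * \<beta> x"] by (simp only: norm_mult)
        then have "norm ((exp (X i * \<beta> x) - 1) / X i) \<le> ?b * exp (norm (X i) * ?b)"
          using X0[rule_format, of i] by (simp add: norm_divide divide_le_eq ac_simps)
        also have "\<dots> \<le> exp ?b * exp (B * ?b)"
          using exp_ge_add_one_self[of ?b] mult_right_mono[OF B[of i], of ?b]
          by (intro mult_mono) (auto intro: order_trans[of _ "1 + ?b"])
        finally have 2: "norm ((exp (X i * \<beta> x) - 1) / X i) \<le> exp ?b * exp (B * ?b)" .
        have "norm (g x * exp (c * \<beta> x) * ((exp (X i * \<beta> x) - 1) / X i))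
            \<le> norm (g x) * exp (norm c * ?b) * (exp ?b * exp (B * ?b))"
          unfolding norm_mult[of "g x * _"] norm_mult[of "g x"]
          by (intro mult_mono mult_nonneg_nonneg 1 2) auto
        also have "\<dots> = norm (g x) * exp ((norm c + B + 1) * ?b)"
          by (simp add: mult_exp_exp algebra_simps)
        finally show "norm (g x * exp (c * \<beta> x) * ((exp (X i * \<beta> x) - 1) / X i))
          \<le> norm (g x) * exp ((norm c + B + 1) * ?b)" .
      qed
    qed measurable
    moreover have "(LINT x|M. g x * exp (c * \<beta> x) * ((exp (X i * \<beta> x) - 1) / X i)) = (F (c + X i) - F c) / X i" for i
    proof -
      have "g x * exp (c * \<beta> x) * ((exp (X i * \<beta> x) - 1) / X i) =
          (g x * exp ((c + X i) * \<beta> x) - g x * exp (c * \<beta> x)) / X i" for x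
        by (simp add: exp_add ring_distribs diff_divide_distrib)
      then show ?thesis
        unfolding F_def by (simp only: integral_divide_zero Bochner_Integration.integral_diff[OF int_F int_F])
    qed
    ultimately show "((\<lambda>h. (F (c + h) - F c) / h) \<circ> X) \<longlonglongrightarrow> (LINT x|M. g x * exp (c * \<beta> x) * \<beta> x)"
      by (simp only: o_def)
  qed
  then show ?thesis
    unfolding F_def[symmetric] by (auto simp: holomorphic_on_def field_differentiable_def intro: has_field_derivative_at_within)
qed

section \<open>Uniqueness of the Fourier transform\<close>

definition fourier_null :: "(real ^ 'd \<Rightarrow> complex) \<Rightarrow> bool" where
  "fourier_null h \<longleftrightarrow> integrable lebesgue h \<and>
     (\<forall>\<omega>. (LINT x|lebesgue. h x * exp (\<i> * of_real (x \<bullet> \<omega>))) = 0)"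

text \<open>Quantifying over all \<open>h\<close> makes the class closed under products. Once it
  contains the indicators of Borel sets, every \<open>h\<close> in \<open>fourier_null\<close> must
  vanish almost everywhere.\<close>

definition null_multiplier :: "(real ^ 'd \<Rightarrow> real) \<Rightarrow> bool" where
  "null_multiplier u \<longleftrightarrow> (\<forall>h. fourier_null h \<longrightarrow> fourier_null (\<lambda>x. h x * of_real (u x)))"

lemma integrable_mult_exp_i:
  fixes h :: "real ^ 'd \<Rightarrow> complex"
  assumes "integrable lebesgue h"
  shows "integrable lebesgue (\<lambda>x. h x * exp (\<i> * of_real (x \<bullet> \<omega>)))"
proof (rule Bochner_Integration.integrable_bound[OF assms])
  have [measurable]: "h \<in> borel_measurable lebesgue" using assms by auto
  have [measurable]: "(\<lambda>x. exp (\<i> * of_real (x \<bullet> \<omega>))) \<in> borel_measurable lebesgue"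
    by (intro continuous_imp_lebesgue_measurable continuous_intros)
  show "(\<lambda>x. h x * exp (\<i> * of_real (x \<bullet> \<omega>))) \<in> borel_measurable lebesgue" by measurable
qed (simp add: norm_mult)

lemma null_multiplier_const: "null_multiplier (\<lambda>x :: real ^ 'd. c)"
proof -
  have "(LINT x|lebesgue. h x * of_real c * exp (\<i> * of_real (x \<bullet> \<omega>))) =
      of_real c * (LINT x|lebesgue. h x * exp (\<i> * of_real (x \<bullet> \<omega>)))" for h :: "real ^ 'd \<Rightarrow> complex" and \<omega>
    by (subst integral_mult_right_zero[symmetric]) (simp add: ac_simps)
  then show ?thesis
    unfolding null_multiplier_def fourier_null_def by simp
qed

lemma null_multiplier_add:
  fixes u v :: "real ^ 'd \<Rightarrow> real"
  assumes "null_multiplier u" "null_multiplier v"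
  shows "null_multiplier (\<lambda>x. u x + v x)"
  unfolding null_multiplier_def
proof (intro allI impI)
  fix h :: "real ^ 'd \<Rightarrow> complex" assume "fourier_null h"
  then have uv: "fourier_null (\<lambda>x. h x * of_real (u x))" "fourier_null (\<lambda>x. h x * of_real (v x))"
    using assms by (auto simp: null_multiplier_def)
  have int: "integrable lebesgue (\<lambda>x. h x * of_real (u x))" "integrable lebesgue (\<lambda>x. h x * of_real (v x))"
    using uv by (auto simp: fourier_null_def)
  show "fourier_null (\<lambda>x. h x * of_real (u x + v x))"
    unfolding fourier_null_def of_real_add distrib_left distrib_right
      Bochner_Integration.integral_add[OF integrable_mult_exp_i[OF int(1)] integrable_mult_exp_i[OF int(2)]]
    using uv by (auto simp: fourier_null_def)
qed

lemma null_multiplier_mult: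
  assumes "null_multiplier u" "null_multiplier v"
  shows "null_multiplier (\<lambda>x. u x * v x)"
  using assms unfolding null_multiplier_def by (auto simp: mult.assoc[symmetric])

text \<open>The sine combines two characters, and multiplication by a character only shifts the
  frequency.\<close>

lemma null_multiplier_sin: "null_multiplier (\<lambda>x :: real ^ 'd. sin (c * x $ l))"
  unfolding null_multiplier_def
proof (intro allI impI)
  fix h :: "real ^ 'd \<Rightarrow> complex" assume h: "fourier_null h"
  let ?e = "c *\<^sub>R axis l 1 :: real ^ 'd"
  have e: "x \<bullet> ?e = c * x $ l" for x by (simp add: inner_axis)
  have sin: "of_real (sin (c * x $ l)) =
      (exp (\<i> * of_real (x \<bullet> ?e)) - exp (\<i> * of_real (x \<bullet> (- ?e)))) / (2 * \<i>)" for x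
    unfolding inner_minus_right e by (simp add: sin_exp_eq sin_of_real[symmetric])
  have int: "integrable lebesgue (\<lambda>x. h x * exp (\<i> * of_real (x \<bullet> \<omega>)))"
    and zero: "(LINT x|lebesgue. h x * exp (\<i> * of_real (x \<bullet> \<omega>))) = 0" for \<omega>
    using h integrable_mult_exp_i by (auto simp: fourier_null_def)
  have eq: "h x * of_real (sin (c * x $ l)) * exp (\<i> * of_real (x \<bullet> \<omega>)) =
     (h x * exp (\<i> * of_real (x \<bullet> (?e + \<omega>))) - h x * exp (\<i> * of_real (x \<bullet> (- ?e + \<omega>)))) / (2 * \<i>)" for x \<omega>
    unfolding sin inner_add_right of_real_add distrib_left exp_add by (simp add: field_simps)
  have "integrable lebesgue (\<lambda>x. h x * of_real (sin (c * x $ l)) * exp (\<i> * of_real (x \<bullet> 0)))"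
    unfolding eq by (intro integrable_divide_zero Bochner_Integration.integrable_diff int)
  moreover have "(LINT x|lebesgue. h x * of_real (sin (c * x $ l)) * exp (\<i> * of_real (x \<bullet> \<omega>))) = 0" for \<omega>
    unfolding eq integral_divide_zero Bochner_Integration.integral_diff[OF int int] zero by simp
  ultimately show "fourier_null (\<lambda>x. h x * of_real (sin (c * x $ l)))"
    unfolding fourier_null_def by simp
qed

text \<open>Dominated convergence with majorant \<open>B * norm (h x)\<close>; every limit that
  enlarges the class is of this kind.\<close>

lemma null_multiplier_limit:
  fixes U :: "nat \<Rightarrow> real ^ 'd \<Rightarrow> real"
  assumes U: "\<And>n. null_multiplier (U n)" and meas: "\<And>n. U n \<in> borel_measurable lebesgue"
    and bound: "\<And>n x. \<bar>U n x\<bar> \<le> B" and lim: "\<And>x. (\<lambda>n. U n x) \<longlonglongrightarrow> u x"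
  shows "null_multiplier u"
  unfolding null_multiplier_def
proof (intro allI impI)
  fix h :: "real ^ 'd \<Rightarrow> complex" assume h: "fourier_null h"
  have [measurable]: "h \<in> borel_measurable lebesgue" using h by (auto simp: fourier_null_def)
  note meas [measurable]
  have [measurable]: "(\<lambda>x. exp (\<i> * of_real (x \<bullet> \<omega>))) \<in> borel_measurable lebesgue" for \<omega> :: "real ^ 'd"
    by (intro continuous_imp_lebesgue_measurable continuous_intros)
  have [measurable]: "u \<in> borel_measurable lebesgue"
    by (rule borel_measurable_LIMSEQ_real[OF lim meas])
  have dom: "integrable lebesgue (\<lambda>x. B * norm (h x))"
    using h by (auto simp: fourier_null_def)
  have ub: "\<bar>u x\<bar> \<le> B" for x
    by (rule LIMSEQ_le_const2[OF tendsto_rabs[OF lim]]) (use bound in auto)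
  have "(\<lambda>n. LINT x|lebesgue. h x * of_real (U n x) * exp (\<i> * of_real (x \<bullet> \<omega>))) \<longlonglongrightarrow>
      (LINT x|lebesgue. h x * of_real (u x) * exp (\<i> * of_real (x \<bullet> \<omega>)))" for \<omega>
  proof (rule integral_dominated_convergence[OF _ _ dom])
    show "AE x in lebesgue. (\<lambda>n. h x * of_real (U n x) * exp (\<i> * of_real (x \<bullet> \<omega>))) \<longlonglongrightarrow>
        h x * of_real (u x) * exp (\<i> * of_real (x \<bullet> \<omega>))"
      by (intro AE_I2 tendsto_intros lim)
    show "AE x in lebesgue. norm (h x * of_real (U n x) * exp (\<i> * of_real (x \<bullet> \<omega>))) \<le> B * norm (h x)" for n
      using bound[of n] by (intro AE_I2) (simp add: norm_mult mult.commute[of B] mult_left_mono)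
  qed measurable
  moreover have "(LINT x|lebesgue. h x * of_real (U n x) * exp (\<i> * of_real (x \<bullet> \<omega>))) = 0" for n \<omega>
    using U[of n] h by (auto simp: null_multiplier_def fourier_null_def)
  ultimately have "(LINT x|lebesgue. h x * of_real (u x) * exp (\<i> * of_real (x \<bullet> \<omega>))) = 0" for \<omega>
    by (simp add: LIMSEQ_const_iff)
  moreover have "integrable lebesgue (\<lambda>x. h x * of_real (u x))"
    by (rule Bochner_Integration.integrable_bound[OF dom])
      (use ub in \<open>auto simp: norm_mult mult.commute intro!: AE_I2 order_trans[OF mult_right_mono abs_ge_self]\<close>)
  ultimately show "fourier_null (\<lambda>x. h x * of_real (u x))"
    unfolding fourier_null_def by simp
qed

text \<open>A linear form turns into a finite sum of sines. The scale \<open>c\<close> is there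
  because \<open>c * sin (t / c)\<close> tends to \<open>t\<close> as \<open>c\<close>
  grows.\<close>

lemma null_multiplier_polynomial_sin:
  fixes p :: "real ^ 'd \<Rightarrow> real"
  assumes "real_polynomial_function p"
  shows "null_multiplier (\<lambda>x. p (\<chi> l. c * sin (x $ l / c)))"
  using assms
proof induction
  case (linear f)
  have f: "f y = (\<Sum>l\<in>UNIV. y $ l * f (axis l 1))" for y
  proof -
    have "y = (\<Sum>l\<in>UNIV. y $ l *\<^sub>R axis l 1)"
      by (simp add: vec_eq_iff axis_def if_distrib cong: if_cong)
    then have "f y = f (\<Sum>l\<in>UNIV. y $ l *\<^sub>R axis l 1)" by simp
    also have "\<dots> = (\<Sum>l\<in>UNIV. y $ l * f (axis l 1))"
      by (simp add: linear_sum[OF bounded_linear.linear[OF linear]]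
          linear_scale[OF bounded_linear.linear[OF linear]])
    finally show ?thesis .
  qed
  have sum: "null_multiplier (\<lambda>x::real ^ 'd. \<Sum>l\<in>S. c * sin (1 / c * x $ l) * f (axis l 1))" if "finite S" for S
    using that
  proof induction
    case empty
    then show ?case using null_multiplier_const[of 0] by simp
  next
    case (insert l S)
    then show ?case
      unfolding sum.insert[OF insert.hyps(1,2)]
      by (intro null_multiplier_add null_multiplier_mult null_multiplier_sin null_multiplier_const)
  qed
  from this[of UNIV] show ?case by (subst f) simp
next
  case (const c)
  then show ?case by (rule null_multiplier_const)
next
  case (add f g)
  then show ?case by (intro null_multiplier_add)
next
  case (mult f g)
  then show ?case by (intro null_multiplier_mult)
qed

lemma mult_sin_div_tendsto: "(\<lambda>n. real (Suc n) * sin (x / real (Suc n))) \<longlonglongrightarrow> x"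
  by real_asymp

text \<open>
  On the range of \<open>x \<mapsto> n sin (x / n)\<close>, taken coordinatewise, \<open>u\<close> is uniformly close to a
  polynomial, and trigonometric polynomials are multipliers.
\<close>

lemma null_multiplier_bounded_continuous:
  fixes u :: "real ^ 'd \<Rightarrow> real"
  assumes cont: "continuous_on UNIV u" and bound: "\<And>x. \<bar>u x\<bar> \<le> B"
  shows "null_multiplier u"
proof -
  define T where "T = (\<lambda>n (x::real ^ 'd). (\<chi> l. real (Suc n) * sin (x $ l / real (Suc n))) :: real ^ 'd)"
  \<comment> \<open>A compact box containing the whole range of \<open>T n\<close>, so that the
    approximation error is uniform over all of space.\<close>
  define Q where "Q = (\<lambda>n::nat. cbox (- (\<chi> l. real (Suc n))) (\<chi> l. real (Suc n)) :: (real ^ 'd) set)"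
  have TQ: "T n x \<in> Q n" for n x
  proof -
    have "\<bar>real (Suc n) * sin t\<bar> \<le> real (Suc n)" for t
      using abs_sin_le_one[of t] by (simp add: abs_mult mult_left_le del: of_nat_Suc)
    then have "- real (Suc n) \<le> real (Suc n) * sin t" "real (Suc n) * sin t \<le> real (Suc n)" for t
      by (simp_all only: abs_le_iff minus_le_iff)
    then show ?thesis by (simp add: T_def Q_def mem_box_cart del: of_nat_Suc)
  qed
  have "\<exists>p. real_polynomial_function p \<and> (\<forall>x\<in>Q n. \<bar>u x - p x\<bar> < 1 / real (Suc n))" for n
  proof -
    obtain g where "real_polynomial_function g" "\<And>x. x \<in> Q n \<Longrightarrow> \<bar>u x - g x\<bar> < 1 / real (Suc n)"
      by (rule Stone_Weierstrass_real_polynomial_function[of "Q n" u "1 / real (Suc n)"])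
        (auto simp: Q_def intro: continuous_on_subset[OF cont])
    then show ?thesis by blast
  qed
  then obtain p where p: "\<And>n. real_polynomial_function (p n)"
    and up: "\<And>n x. x \<in> Q n \<Longrightarrow> \<bar>u x - p n x\<bar> < 1 / real (Suc n)" by metis
  have contT: "continuous_on UNIV (T n)" for n
    unfolding T_def by (intro continuous_intros) auto
  have contp: "continuous_on S (p n)" for n S
    using p continuous_on_polymonial_function real_polynomial_function_eq by blast
  show ?thesis
  proof (rule null_multiplier_limit[where U = "\<lambda>n x. p n (T n x)" and B = "B + 1"])
    show "null_multiplier (\<lambda>x. p n (T n x))" for n
      unfolding T_def by (rule null_multiplier_polynomial_sin[OF p])
    show "(\<lambda>x. p n (T n x)) \<in> borel_measurable lebesgue" for n
      by (intro continuous_imp_lebesgue_measurable continuous_on_compose2[OF contp contT]) auto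
    show "\<bar>p n (T n x)\<bar> \<le> B + 1" for n x
    proof -
      have "1 / real (Suc n) \<le> 1" by simp
      then show ?thesis using up[OF TQ[of n x]] bound[of "T n x"] by linarith
    qed
    show "(\<lambda>n. p n (T n x)) \<longlonglongrightarrow> u x" for x
    proof -
      have "(\<lambda>n. T n x) \<longlonglongrightarrow> (\<chi> l. x $ l)"
        unfolding T_def by (intro vec_tendstoI) (simp add: mult_sin_div_tendsto del: of_nat_Suc)
      then have "(\<lambda>n. u (T n x)) \<longlonglongrightarrow> u x"
        using cont by (intro continuous_on_tendsto_compose[OF cont]) auto
      moreover have "(\<lambda>n. p n (T n x) - u (T n x)) \<longlonglongrightarrow> 0"
      proof (rule Lim_null_comparison)
        show "\<forall>\<^sub>F n in sequentially. norm (p n (T n x) - u (T n x)) \<le> 1 / real (Suc n)"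
          using up[OF TQ] by (intro always_eventually) (auto simp: abs_minus_commute less_imp_le)
        show "(\<lambda>n. 1 / real (Suc n)) \<longlonglongrightarrow> 0" by real_asymp
      qed
      ultimately have "(\<lambda>n. (p n (T n x) - u (T n x)) + u (T n x)) \<longlonglongrightarrow> 0 + u x" by (intro tendsto_add)
      then show ?thesis by simp
    qed
  qed
qed

section \<open>Indicators of Borel sets and vanishing almost everywhere\<close>

lemma null_multiplier_indicator_empty: "null_multiplier (indicat_real ({} :: (real ^ 'd) set))"
  using null_multiplier_const[of 0] by (simp add: indicator_def[abs_def])

lemma null_multiplier_indicator_closed:
  fixes S :: "(real ^ 'd) set"
  assumes S: "closed S"
  shows "null_multiplier (indicat_real S)"
\<comment> \<open>By convention \<open>infdist x {} = 0\<close>, so for the empty set the functions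
  \<open>?U n\<close> would tend to 1 instead of 0.\<close>
proof (cases "S = {}")
  case True
  then show ?thesis using null_multiplier_indicator_empty by simp
next
  case False
  let ?U = "\<lambda>n x. 1 / (1 + real n * infdist x S)"
  have pos: "1 + real n * infdist x S \<ge> 1" for n x
    using mult_nonneg_nonneg[OF of_nat_0_le_iff infdist_nonneg, of n x S] by linarith
  have cont: "continuous_on UNIV (?U n)" for n
    using pos by (intro continuous_intros ballI) (use pos[of n] in \<open>metis not_one_le_zero\<close>)
  have bd: "\<bar>?U n x\<bar> \<le> 1" for n x using pos[of n x] by simp
  show ?thesis
  proof (rule null_multiplier_limit[where U = ?U, OF null_multiplier_bounded_continuous[OF cont bd] _ bd])
    show "?U n \<in> borel_measurable lebesgue" for n
      by (intro continuous_imp_lebesgue_measurable cont)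
    show "(\<lambda>n. ?U n x) \<longlonglongrightarrow> indicat_real S x" for x
    proof (cases "x \<in> S")
      case False
      then have "infdist x S > 0" using infdist_pos_not_in_closed[OF S \<open>S \<noteq> {}\<close>] by blast
      then have "(\<lambda>n. ?U n x) \<longlonglongrightarrow> 0" by real_asymp
      then show ?thesis using False by simp
    qed simp
  qed
qed

text \<open>Dynkin's theorem with the closed sets as intersection-stable generator.\<close>

lemma null_multiplier_indicator_borel:
  fixes S :: "(real ^ 'd) set"
  assumes "S \<in> sets borel"
  shows "null_multiplier (indicat_real S)"
proof -
  have "Int_stable (Collect closed :: (real ^ 'd) set set)" by (auto simp: Int_stable_def)
  moreover have "Collect closed \<subseteq> Pow (UNIV :: (real ^ 'd) set)" by simp
  moreover have "S \<in> sigma_sets UNIV (Collect closed)" using assms by (simp add: borel_eq_closed)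
  ultimately have "S \<in> sets borel \<and> null_multiplier (indicat_real S)"
  proof (induction rule: sigma_sets_induct_disjoint)
    case (basic A)
    then show ?case using null_multiplier_indicator_closed by auto
  next
    case empty
    show ?case by (intro conjI null_multiplier_indicator_empty) simp
  next
    case (compl A)
    have "null_multiplier (\<lambda>x. 1 + (- 1) * indicat_real A x)"
      using compl by (intro null_multiplier_add null_multiplier_mult null_multiplier_const) auto
    moreover have "(\<lambda>x. 1 + (- 1) * indicat_real A x) = indicat_real (UNIV - A)"
      by (auto simp: indicator_def)
    ultimately show ?case using compl by auto
  next
    case (union A)
    have fin: "null_multiplier (indicat_real (\<Union>i<n. A i))" for n
    proof (induction n)
      case 0
      show ?case by (simp only: lessThan_0 UN_empty null_multiplier_indicator_empty)
    next
      case (Suc n)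
      have "null_multiplier (\<lambda>x. indicat_real (\<Union>i<n. A i) x + indicat_real (A n) x)"
        using Suc union by (intro null_multiplier_add) auto
      moreover have "(\<lambda>x. indicat_real (\<Union>i<n. A i) x + indicat_real (A n) x) = indicat_real (\<Union>i<Suc n. A i)"
      proof
        fix x
        have "x \<notin> A i" if "x \<in> A n" "i < n" for i
          using disjoint_family_onD[OF union(1), of i n] that by auto
        then show "indicat_real (\<Union>i<n. A i) x + indicat_real (A n) x = indicat_real (\<Union>i<Suc n. A i) x"
          by (auto simp: indicator_def less_Suc_eq)
      qed
      ultimately show ?case by simp
    qed
    have "null_multiplier (indicat_real (\<Union>i. A i))"
    proof (rule null_multiplier_limit[where U = "\<lambda>n. indicat_real (\<Union>i<n. A i)" and B = 1, OF fin])
      have "(\<Union>i<n. A i) \<in> sets lebesgue" for n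
        using union by (auto simp: sets_completionI_sets)
      then show "indicat_real (\<Union>i<n. A i) \<in> borel_measurable lebesgue" for n
        by (rule borel_measurable_indicator)
      show "(\<lambda>n. indicat_real (\<Union>i<n. A i) x) \<longlonglongrightarrow> indicat_real (\<Union>i. A i) x" for x
        by (rule LIMSEQ_indicator_UN)
    qed (auto simp: indicator_def)
    then show ?case using union by auto
  qed
  then show ?thesis by simp
qed

text \<open>Frequency 0 of \<open>h\<close> times an indicator shows that \<open>h\<close> has
  integral 0 over Borel sets, and a Lebesgue set differs from a Borel set by a null set.\<close>

lemma fourier_null_imp_AE_0:
  fixes h :: "real ^ 'd \<Rightarrow> complex"
  assumes h: "fourier_null h"
  shows "AE x in lebesgue. h x = 0"
proof -
  have int: "integrable lebesgue h" using h by (simp add: fourier_null_def)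
  show ?thesis
  proof (rule sigma_finite_measure.density_zero[OF sigma_finite_lebesgue int])
    fix A :: "(real ^ 'd) set" assume A: "A \<in> sets lebesgue"
    then obtain S N N' where S: "A = S \<union> N" "N \<subseteq> N'" "N' \<in> null_sets lborel" "S \<in> sets lborel"
      by (rule sets_completionE)
    have "AE x in lebesgue. x \<notin> N'" using S(3) by (intro AE_completion AE_not_in)
    then have "AE x in lebesgue. indicat_real A x *\<^sub>R h x = indicat_real S x *\<^sub>R h x"
      by eventually_elim (use S in \<open>auto simp: indicator_def\<close>)
    then have "set_lebesgue_integral lebesgue A h = set_lebesgue_integral lebesgue S h"
      unfolding set_lebesgue_integral_def using A S(4) int
      by (intro integral_cong_AE borel_measurable_scaleR borel_measurable_indicator) (auto simp: sets_completionI_sets)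
    also have "\<dots> = 0"
    proof -
      have "fourier_null (\<lambda>x. h x * of_real (indicat_real S x))"
        using null_multiplier_indicator_borel[of S] S(4) h by (simp add: null_multiplier_def)
      then have "(LINT x|lebesgue. h x * of_real (indicat_real S x) * exp (\<i> * of_real (x \<bullet> 0))) = 0"
        unfolding fourier_null_def by blast
      then show ?thesis
        by (simp add: set_lebesgue_integral_def scaleR_conv_of_real mult.commute)
    qed
    finally show "set_lebesgue_integral lebesgue A h = 0" .
  qed
qed

section \<open>The Fock transform\<close>

text \<open>Bilinear rather than Hermitian, hence holomorphic in \<open>z\<close>.\<close>

definition cdot :: "real ^ 'd \<Rightarrow> complex ^ 'd \<Rightarrow> complex" where
  "cdot x z = (\<Sum>l\<in>UNIV. of_real (x $ l) * z $ l)"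

text \<open>Up to a constant this is the Bargmann transform times \<open>exp (pi z^2 / 2)\<close>,
  where \<open>z^2\<close> is the sum of the squared coordinates. With this factor the growth
  depends on the real part of \<open>z\<close> alone.\<close>

definition fock :: "(real ^ 'd \<Rightarrow> complex) \<Rightarrow> complex ^ 'd \<Rightarrow> complex" where
  "fock f z = (LINT x|lebesgue. f x * of_real (gaussian x) * exp (2 * of_real pi * cdot x z))"

definition re_vec :: "complex ^ 'd \<Rightarrow> real ^ 'd" where "re_vec z = (\<chi> l. Re (z $ l))"

lemma Re_cdot: "Re (cdot x z) = x \<bullet> re_vec z"
  by (simp add: cdot_def re_vec_def inner_vec_def)

lemma cdot_add: "cdot x (z + w) = cdot x z + cdot x w"
  by (simp add: cdot_def sum.distrib ring_distribs)

lemma cdot_vec_upd: "cdot x (vec_upd z l c) = cdot x (vec_upd z l 0) + c * of_real (x $ l)"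
proof -
  have "cdot x (vec_upd z l c) = of_real (x $ l) * c + (\<Sum>k\<in>UNIV - {l}. of_real (x $ k) * z $ k)" for c
    unfolding cdot_def by (subst sum.remove[of UNIV l]) (auto simp: vec_upd_nth intro!: sum.cong)
  from this[of c] this[of 0] show ?thesis by simp
qed

lemma cdot_scale: "cdot x (\<chi> l. c * z $ l) = c * cdot x z"
  by (simp add: cdot_def sum_distrib_left ac_simps)

lemma continuous_on_cdot [continuous_intros]: "continuous_on S (\<lambda>x. cdot x z)"
  unfolding cdot_def by (intro continuous_intros)

lemma norm_cdot_le: "norm (cdot x z) \<le> norm x * (\<Sum>l\<in>UNIV. norm (z $ l))"
proof -
  have "norm (cdot x z) \<le> (\<Sum>l\<in>UNIV. norm x * norm (z $ l))"
    unfolding cdot_def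
    by (rule sum_norm_le) (simp add: norm_mult mult_right_mono component_le_norm_cart)
  then show ?thesis by (simp add: sum_distrib_left)
qed

lemma continuous_on_gaussian [continuous_intros]:
  "continuous_on S f \<Longrightarrow> continuous_on S (\<lambda>x. gaussian (f x))"
  unfolding gaussian_def by (intro continuous_intros)

lemma gaussian_pos: "gaussian x > 0" by (simp add: gaussian_def)

lemma gaussian_diff: "gaussian (x - t) = gaussian x * gaussian t * exp (2 * pi * (x \<bullet> t))"
  unfolding gaussian_def exp_add[symmetric] power2_norm_eq_inner
  by (simp add: inner_diff_left inner_diff_right inner_commute algebra_simps)

lemma L2_measurable: "f \<in> L2_functions \<Longrightarrow> f \<in> borel_measurable lebesgue"
  by (simp add: L2_functions_def)

text \<open>The elementary bound \<open>s * t <= s^2 + t^2\<close> suffices, since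
  \<open>norm_fock_le\<close> asks only for some constant that does not change under translation of
  \<open>g\<close>.\<close>

lemma integrable_mult_L2:
  fixes f :: "real ^ 'd \<Rightarrow> complex"
  assumes f: "f \<in> L2_functions" and g: "g \<in> borel_measurable lebesgue"
    and g2: "integrable lebesgue (\<lambda>x. (g x)\<^sup>2)" and g0: "\<And>x. g x \<ge> (0::real)"
  shows "integrable lebesgue (\<lambda>x. norm (f x) * g x)"
    and "(LINT x|lebesgue. norm (f x) * g x) \<le> (LINT x|lebesgue. (norm (f x))\<^sup>2) + (LINT x|lebesgue. (g x)\<^sup>2)"
proof -
  have [measurable]: "f \<in> borel_measurable lebesgue" "g \<in> borel_measurable lebesgue"
    using f g by (auto simp: L2_functions_def)
  have f2: "integrable lebesgue (\<lambda>x. (norm (f x))\<^sup>2)" using f by (simp add: L2_functions_def)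
  have le: "norm (f x) * g x \<le> (norm (f x))\<^sup>2 + (g x)\<^sup>2" for x
    using sum_squares_bound[of "norm (f x)" "g x"] mult_nonneg_nonneg[OF norm_ge_zero g0, of "f x" x]
    by linarith
  show int: "integrable lebesgue (\<lambda>x. norm (f x) * g x)"
    by (rule Bochner_Integration.integrable_bound[OF Bochner_Integration.integrable_add[OF f2 g2]])
      (use le g0 in \<open>auto intro!: AE_I2\<close>)
  have "(LINT x|lebesgue. norm (f x) * g x) \<le> (LINT x|lebesgue. (norm (f x))\<^sup>2 + (g x)\<^sup>2)"
    by (rule integral_mono[OF int Bochner_Integration.integrable_add[OF f2 g2] le])
  then show "(LINT x|lebesgue. norm (f x) * g x) \<le> (LINT x|lebesgue. (norm (f x))\<^sup>2) + (LINT x|lebesgue. (g x)\<^sup>2)"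
    by (simp only: Bochner_Integration.integral_add[OF f2 g2])
qed

text \<open>Completing the square costs half of the Gaussian decay; the other half keeps the
  right-hand side integrable.\<close>

lemma gaussian_exp_norm_sq_le:
  "(gaussian x * exp (r * norm x))\<^sup>2 \<le> exp (r\<^sup>2 / pi) * exp (- pi * (norm x)\<^sup>2)"
proof -
  have "0 \<le> (sqrt pi * norm x - r / sqrt pi)\<^sup>2" by simp
  also have "\<dots> = pi * (norm x)\<^sup>2 - 2 * r * norm x + r\<^sup>2 / pi"
    by (simp add: power2_diff power_mult_distrib power_divide)
  finally have "2 * (- pi * (norm x)\<^sup>2 + r * norm x) \<le> r\<^sup>2 / pi + - pi * (norm x)\<^sup>2" by simp
  then show ?thesis
    unfolding gaussian_def exp_add[symmetric] exp_double[symmetric] by simp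
qed

lemma integrable_L2_gaussian_exp:
  fixes f :: "real ^ 'd \<Rightarrow> complex"
  assumes f: "f \<in> L2_functions"
  shows "integrable lebesgue (\<lambda>x. norm (f x) * (gaussian x * exp (r * norm x)))"
proof (rule integrable_mult_L2[OF f])
  show meas: "(\<lambda>x::real ^ 'd. gaussian x * exp (r * norm x)) \<in> borel_measurable lebesgue"
    by (intro continuous_imp_lebesgue_measurable continuous_intros)
  have "integrable lebesgue (\<lambda>x::real ^ 'd. exp (r\<^sup>2 / pi) * exp (- pi * (norm x)\<^sup>2))"
    by (intro integrable_mult_right integrable_gaussian) simp
  then show "integrable lebesgue (\<lambda>x::real ^ 'd. (gaussian x * exp (r * norm x))\<^sup>2)"
    by (rule Bochner_Integration.integrable_bound)
      (use meas gaussian_exp_norm_sq_le[of _ r] in \<open>auto intro!: AE_I2\<close>)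
  show "gaussian x * exp (r * norm x) \<ge> 0" for x using gaussian_pos[of x] by simp
qed

lemma integrable_fock:
  fixes f :: "real ^ 'd \<Rightarrow> complex"
  assumes f: "f \<in> L2_functions"
  shows "integrable lebesgue (\<lambda>x. f x * of_real (gaussian x) * exp (2 * of_real pi * cdot x z))"
proof (rule Bochner_Integration.integrable_bound[OF integrable_L2_gaussian_exp[OF f]])
  have m: "(\<lambda>x. of_real (gaussian x) * exp (2 * of_real pi * cdot x z) :: complex) \<in> borel_measurable lebesgue"
    by (intro continuous_imp_lebesgue_measurable continuous_intros)
  show "(\<lambda>x. f x * of_real (gaussian x) * exp (2 * of_real pi * cdot x z)) \<in> borel_measurable lebesgue"
    using borel_measurable_times[OF L2_measurable[OF f] m] by (simp only: mult.assoc)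
  show "AE x in lebesgue. norm (f x * of_real (gaussian x) * exp (2 * of_real pi * cdot x z))
      \<le> norm (norm (f x) * (gaussian x * exp (2 * pi * (\<Sum>l\<in>UNIV. norm (z $ l)) * norm x)))"
  proof (rule AE_I2)
    fix x :: "real ^ 'd"
    have "Re (cdot x z) \<le> norm x * (\<Sum>l\<in>UNIV. norm (z $ l))"
      using complex_Re_le_cmod[of "cdot x z"] norm_cdot_le[of x z] by linarith
    then have "2 * pi * Re (cdot x z) \<le> 2 * pi * (\<Sum>l\<in>UNIV. norm (z $ l)) * norm x" by (simp add: ac_simps)
    then have "norm (f x) * gaussian x * exp (2 * pi * Re (cdot x z)) \<le>
        norm (f x) * gaussian x * exp (2 * pi * (\<Sum>l\<in>UNIV. norm (z $ l)) * norm x)"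
      using gaussian_pos[of x] by (intro mult_left_mono) auto
    then show "norm (f x * of_real (gaussian x) * exp (2 * of_real pi * cdot x z))
      \<le> norm (norm (f x) * (gaussian x * exp (2 * pi * (\<Sum>l\<in>UNIV. norm (z $ l)) * norm x)))"
      using gaussian_pos[of x] by (simp add: norm_mult ac_simps)
  qed
qed

text \<open>Requiring just that \<open>cdot x (\<gamma> c)\<close> be affine in \<open>c\<close>
  covers coordinate lines and arbitrary complex lines alike.\<close>

lemma fock_holomorphic_line:
  fixes f :: "real ^ 'd \<Rightarrow> complex"
  assumes f: "f \<in> L2_functions"
    and line: "\<And>x c. cdot x (\<gamma> c) = cdot x z + c * cdot x v"
  shows "(\<lambda>c. fock f (\<gamma> c)) holomorphic_on UNIV"
proof -
  let ?g = "\<lambda>x. f x * of_real (gaussian x) * exp (2 * of_real pi * cdot x z)"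
  let ?b = "\<lambda>x. 2 * of_real pi * cdot x v"
  have m: "(\<lambda>x. of_real (gaussian x) * exp (2 * of_real pi * cdot x z) :: complex) \<in> borel_measurable lebesgue"
    by (intro continuous_imp_lebesgue_measurable continuous_intros)
  have mg [measurable]: "?g \<in> borel_measurable lebesgue"
    using borel_measurable_times[OF L2_measurable[OF f] m] by (simp only: mult.assoc)
  have mb [measurable]: "?b \<in> borel_measurable lebesgue"
    by (intro continuous_imp_lebesgue_measurable continuous_intros)
  have "(\<lambda>c. LINT x|lebesgue. ?g x * exp (c * ?b x)) holomorphic_on UNIV"
  proof (rule holomorphic_integral_exp[OF mg mb])
    fix r :: real assume r: "r \<ge> 0"
    define R where "R = 2 * pi * (\<Sum>l\<in>UNIV. norm (z $ l)) + r * (2 * pi * (\<Sum>l\<in>UNIV. norm (v $ l)))"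
    show "integrable lebesgue (\<lambda>x. norm (?g x) * exp (r * norm (?b x)))"
    proof (rule Bochner_Integration.integrable_bound[OF integrable_L2_gaussian_exp[OF f, of R]])
      show "AE x in lebesgue. norm (norm (?g x) * exp (r * norm (?b x))) \<le> norm (norm (f x) * (gaussian x * exp (R * norm x)))"
      proof (rule AE_I2)
        fix x :: "real ^ 'd"
        have "Re (cdot x z) \<le> norm x * (\<Sum>l\<in>UNIV. norm (z $ l))"
          using complex_Re_le_cmod[of "cdot x z"] norm_cdot_le[of x z] by linarith
        then have 1: "2 * pi * Re (cdot x z) \<le> 2 * pi * (norm x * (\<Sum>l\<in>UNIV. norm (z $ l)))" by simp
        have "r * norm (?b x) = r * (2 * pi * norm (cdot x v))" by (simp add: norm_mult)
        also have "\<dots> \<le> r * (2 * pi * (norm x * (\<Sum>l\<in>UNIV. norm (v $ l))))"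
          using r norm_cdot_le[of x v] by (intro mult_left_mono) auto
        finally have "2 * pi * Re (cdot x z) + r * norm (?b x) \<le>
            2 * pi * (norm x * (\<Sum>l\<in>UNIV. norm (z $ l))) + r * (2 * pi * (norm x * (\<Sum>l\<in>UNIV. norm (v $ l))))"
          by (rule add_mono[OF 1])
        also have "\<dots> = R * norm x" by (simp add: R_def algebra_simps)
        finally have "2 * pi * Re (cdot x z) + r * norm (?b x) \<le> R * norm x" .
        then have "exp (2 * pi * Re (cdot x z)) * exp (r * norm (?b x)) \<le> exp (R * norm x)"
          unfolding exp_add[symmetric] by simp
        then have "norm (f x) * gaussian x * (exp (2 * pi * Re (cdot x z)) * exp (r * norm (?b x))) \<le>
            norm (f x) * gaussian x * exp (R * norm x)"
          using gaussian_pos[of x] by (intro mult_left_mono) auto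
        then show "norm (norm (?g x) * exp (r * norm (?b x))) \<le> norm (norm (f x) * (gaussian x * exp (R * norm x)))"
          using gaussian_pos[of x] by (simp add: norm_mult ac_simps)
      qed
    qed measurable
  qed
  moreover have "?g x * exp (c * ?b x) = f x * of_real (gaussian x) * exp (2 * of_real pi * cdot x (\<gamma> c))" for x c
    unfolding line by (simp add: mult.assoc mult_exp_exp algebra_simps)
  ultimately show ?thesis unfolding fock_def by simp
qed

lemma fock_holomorphic_coordinate:
  assumes "f \<in> L2_functions"
  shows "(\<lambda>c. fock f (vec_upd z l c)) holomorphic_on UNIV"
proof (rule fock_holomorphic_line[OF assms, where z = "vec_upd z l 0" and v = "axis l 1"])
  have "cdot x (axis l 1) = of_real (x $ l)" for x
    by (simp add: cdot_def axis_def if_distrib cong: if_cong)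
  then show "cdot x (vec_upd z l c) = cdot x (vec_upd z l 0) + c * cdot x (axis l 1)" for x c
    by (subst cdot_vec_upd) simp
qed

lemma gabor_eq_fock:
  "gabor f t \<omega> = of_real (gaussian t) * fock f (\<chi> l. Complex (t $ l) (- \<omega> $ l))"
proof -
  have cdot: "cdot x (\<chi> l. Complex (t $ l) (- \<omega> $ l)) = of_real (x \<bullet> t) - \<i> * of_real (x \<bullet> \<omega>)" for x
    by (simp add: complex_eq_iff Re_cdot re_vec_def inner_vec_def) (simp add: cdot_def inner_vec_def sum_negf)
  have eq: "f x * of_real (gaussian (x - t)) * exp (- 2 * of_real pi * \<i> * of_real (x \<bullet> \<omega>)) =
      of_real (gaussian t) * (f x * of_real (gaussian x) *
        exp (2 * of_real pi * cdot x (\<chi> l. Complex (t $ l) (- \<omega> $ l))))" for x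
    unfolding gaussian_diff cdot
    by (simp add: exp_of_real[symmetric] right_diff_distrib exp_diff exp_minus field_simps)
  show ?thesis unfolding gabor_def fock_def eq by simp
qed

text \<open>With \<open>t = re_vec z\<close>, the modulus of the kernel is
  \<open>exp (pi |t|^2) * gaussian (x - t)\<close>, and the square integral of the shifted Gaussian
  is independent of \<open>t\<close>.\<close>

lemma norm_fock_le:
  fixes f :: "real ^ 'd \<Rightarrow> complex"
  assumes f: "f \<in> L2_functions"
  obtains C where "C \<ge> 0" "\<And>z. norm (fock f z) \<le> C * exp (pi * (norm (re_vec z))\<^sup>2)"
proof
  define C where "C = (LINT x|lebesgue. (norm (f x))\<^sup>2) + (LINT x|lebesgue. (gaussian (x::real ^ 'd))\<^sup>2)"
  show "C \<ge> 0" unfolding C_def by simp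
  fix z :: "complex ^ 'd"
  let ?t = "re_vec z"
  have contsq: "continuous_on UNIV (\<lambda>x::real ^ 'd. (gaussian x)\<^sup>2)" by (intro continuous_intros)
  have tr: "(LINT x|lebesgue. (gaussian (x - ?t))\<^sup>2) = (LINT x|lebesgue. (gaussian (x::real ^ 'd))\<^sup>2)"
    using lebesgue_integral_translate[OF contsq, of "- ?t"] by simp
  have "integrable lebesgue (\<lambda>x::real ^ 'd. (gaussian (x - ?t))\<^sup>2)"
  proof (rule Bochner_Integration.integrable_bound)
    show "integrable lebesgue (\<lambda>x::real ^ 'd. (gaussian ?t)\<^sup>2 * (exp ((2 * pi * norm ?t)\<^sup>2 / pi) * exp (- pi * (norm x)\<^sup>2)))"
      by (intro integrable_mult_right integrable_gaussian) simp
    show "(\<lambda>x::real ^ 'd. (gaussian (x - ?t))\<^sup>2) \<in> borel_measurable lebesgue"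
      by (intro continuous_imp_lebesgue_measurable continuous_intros)
    show "AE x in lebesgue. norm ((gaussian (x - ?t))\<^sup>2) \<le>
        norm ((gaussian ?t)\<^sup>2 * (exp ((2 * pi * norm ?t)\<^sup>2 / pi) * exp (- pi * (norm x)\<^sup>2)))"
    proof (rule AE_I2)
      fix x :: "real ^ 'd"
      have "x \<bullet> ?t \<le> norm ?t * norm x" using norm_cauchy_schwarz[of x ?t] by (simp add: mult.commute)
      then have "gaussian x * exp (2 * pi * (x \<bullet> ?t)) \<le> gaussian x * exp (2 * pi * norm ?t * norm x)"
        using gaussian_pos[of x] by (intro mult_left_mono) auto
      then have "(gaussian x * exp (2 * pi * (x \<bullet> ?t)))\<^sup>2 \<le> (gaussian x * exp (2 * pi * norm ?t * norm x))\<^sup>2"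
        using gaussian_pos[of x] by (intro power_mono) auto
      also have "\<dots> \<le> exp ((2 * pi * norm ?t)\<^sup>2 / pi) * exp (- pi * (norm x)\<^sup>2)"
        by (rule gaussian_exp_norm_sq_le)
      finally have "(gaussian ?t)\<^sup>2 * (gaussian x * exp (2 * pi * (x \<bullet> ?t)))\<^sup>2 \<le>
          (gaussian ?t)\<^sup>2 * (exp ((2 * pi * norm ?t)\<^sup>2 / pi) * exp (- pi * (norm x)\<^sup>2))"
        by (intro mult_left_mono) auto
      moreover have "(gaussian (x - ?t))\<^sup>2 = (gaussian ?t)\<^sup>2 * (gaussian x * exp (2 * pi * (x \<bullet> ?t)))\<^sup>2"
        unfolding gaussian_diff by (simp add: power_mult_distrib)
      ultimately show "norm ((gaussian (x - ?t))\<^sup>2) \<le>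
        norm ((gaussian ?t)\<^sup>2 * (exp ((2 * pi * norm ?t)\<^sup>2 / pi) * exp (- pi * (norm x)\<^sup>2)))" by simp
    qed
  qed
  note L2 = integrable_mult_L2[OF f _ this less_imp_le[OF gaussian_pos]]
  have meas: "(\<lambda>x::real ^ 'd. gaussian (x - ?t)) \<in> borel_measurable lebesgue"
    by (intro continuous_imp_lebesgue_measurable continuous_intros)
  have n: "norm (f x * of_real (gaussian x) * exp (2 * of_real pi * cdot x z)) =
      exp (pi * (norm ?t)\<^sup>2) * (norm (f x) * gaussian (x - ?t))" for x
  proof -
    have "gaussian (x - ?t) * exp (pi * (norm ?t)\<^sup>2) = gaussian x * exp (2 * pi * (x \<bullet> ?t))"
      unfolding gaussian_diff by (simp add: gaussian_def[of ?t] exp_minus field_simps)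
    moreover have "norm (f x * of_real (gaussian x) * exp (2 * of_real pi * cdot x z)) =
        norm (f x) * (gaussian x * exp (2 * pi * (x \<bullet> ?t)))"
      using gaussian_pos[of x] by (simp add: norm_mult Re_cdot)
    ultimately show ?thesis by (simp only: ac_simps)
  qed
  have "norm (fock f z) \<le> (LINT x|lebesgue. norm (f x * of_real (gaussian x) * exp (2 * of_real pi * cdot x z)))"
    unfolding fock_def by (rule integral_norm_bound)
  also have "\<dots> = exp (pi * (norm ?t)\<^sup>2) * (LINT x|lebesgue. norm (f x) * gaussian (x - ?t))"
    unfolding n by simp
  also have "\<dots> \<le> exp (pi * (norm ?t)\<^sup>2) * C"
    using L2(2)[OF meas] unfolding tr C_def by (intro mult_left_mono) auto
  finally show "norm (fock f z) \<le> C * exp (pi * (norm ?t)\<^sup>2)" by (simp only: mult.commute)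
qed

section \<open>Linearity and injectivity of the Fock transform\<close>

lemma L2_functions_lincomb:
  assumes f: "f \<in> L2_functions" and g: "g \<in> L2_functions"
  shows "(\<lambda>x. a * f x + b * g x) \<in> L2_functions"
proof -
  note [measurable] = L2_measurable[OF f] L2_measurable[OF g]
  have "integrable lebesgue (\<lambda>x. 2 * (norm a)\<^sup>2 * (norm (f x))\<^sup>2 + 2 * (norm b)\<^sup>2 * (norm (g x))\<^sup>2)"
    using f g by (intro Bochner_Integration.integrable_add integrable_mult_right) (auto simp: L2_functions_def)
  then have "integrable lebesgue (\<lambda>x. (norm (a * f x + b * g x))\<^sup>2)"
  proof (rule Bochner_Integration.integrable_bound)
    show "AE x in lebesgue. norm ((norm (a * f x + b * g x))\<^sup>2) \<le>
      norm (2 * (norm a)\<^sup>2 * (norm (f x))\<^sup>2 + 2 * (norm b)\<^sup>2 * (norm (g x))\<^sup>2)"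
    proof (rule AE_I2)
      fix x
      have "norm (a * f x + b * g x) \<le> norm a * norm (f x) + norm b * norm (g x)"
        using norm_triangle_ineq[of "a * f x" "b * g x"] by (simp only: norm_mult)
      then have "(norm (a * f x + b * g x))\<^sup>2 \<le> (norm a * norm (f x) + norm b * norm (g x))\<^sup>2"
        by (intro power_mono) auto
      also have "\<dots> \<le> 2 * (norm a * norm (f x))\<^sup>2 + 2 * (norm b * norm (g x))\<^sup>2"
        using sum_squares_bound[of "norm a * norm (f x)" "norm b * norm (g x)"]
        by (simp add: power2_sum)
      finally show "norm ((norm (a * f x + b * g x))\<^sup>2) \<le>
        norm (2 * (norm a)\<^sup>2 * (norm (f x))\<^sup>2 + 2 * (norm b)\<^sup>2 * (norm (g x))\<^sup>2)"
        by (simp add: power_mult_distrib)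
    qed
  qed measurable
  then show ?thesis by (simp add: L2_functions_def)
qed

lemma fock_lincomb:
  assumes f: "f \<in> L2_functions" and g: "g \<in> L2_functions"
  shows "fock (\<lambda>x. a * f x + b * g x) z = a * fock f z + b * fock g z"
proof -
  have "(a * f x + b * g x) * of_real (gaussian x) * exp (2 * of_real pi * cdot x z) =
     a * (f x * of_real (gaussian x) * exp (2 * of_real pi * cdot x z)) +
     b * (g x * of_real (gaussian x) * exp (2 * of_real pi * cdot x z))" for x
    by (simp add: algebra_simps)
  then show ?thesis
    unfolding fock_def using integrable_fock[OF f] integrable_fock[OF g]
    by (simp add: Bochner_Integration.integral_add)
qed

text \<open>At purely imaginary points the Fock transform is the Fourier transform of
  \<open>f\<close> times the Gaussian, and the Gaussian has no zeros.\<close>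

lemma fock_eq_0_imp_AE_0:
  fixes f :: "real ^ 'd \<Rightarrow> complex"
  assumes f: "f \<in> L2_functions" and zero: "\<And>z. fock f z = 0"
  shows "AE x in lebesgue. f x = 0"
proof -
  have "fourier_null (\<lambda>x. f x * of_real (gaussian x))"
    unfolding fourier_null_def
  proof (intro conjI allI)
    have "cdot x 0 = 0" for x :: "real ^ 'd" by (simp add: cdot_def)
    then show "integrable lebesgue (\<lambda>x. f x * of_real (gaussian x))"
      using integrable_fock[OF f, of 0] by simp
    fix \<omega> :: "real ^ 'd"
    have "2 * of_real pi * cdot x (\<chi> l. \<i> * of_real (\<omega> $ l / (2 * pi))) = \<i> * of_real (x \<bullet> \<omega>)" for x
      by (simp add: cdot_def inner_vec_def sum_distrib_left field_simps)
    then show "(LINT x|lebesgue. f x * of_real (gaussian x) * exp (\<i> * of_real (x \<bullet> \<omega>))) = 0"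
      using zero[of "\<chi> l. \<i> * of_real (\<omega> $ l / (2 * pi))"] by (simp add: fock_def)
  qed
  then have "AE x in lebesgue. f x * of_real (gaussian x) = 0" by (rule fourier_null_imp_AE_0)
  then show ?thesis by eventually_elim (metis gaussian_pos less_irrefl mult_eq_0_iff of_real_eq_0_iff)
qed

section \<open>Phase retrieval\<close>

lemma sqrt_ints_uminus: "s \<in> sqrt_ints \<Longrightarrow> - s \<in> sqrt_ints"
  unfolding sqrt_ints_def by auto

lemma norm_re_vec_vec_upd:
  "(norm (re_vec (vec_upd z l c)))\<^sup>2 = (norm (re_vec (vec_upd z l 0)))\<^sup>2 + (Re c)\<^sup>2"
proof -
  have "(norm (re_vec (vec_upd z l c)))\<^sup>2 = (Re c)\<^sup>2 + (\<Sum>k\<in>UNIV - {l}. (Re (z $ k))\<^sup>2)" for c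
    unfolding power2_norm_eq_inner inner_vec_def
    by (subst sum.remove[of UNIV l]) (auto simp: re_vec_def vec_upd_nth power2_eq_square intro!: sum.cong)
  from this[of c] this[of 0] show ?thesis by simp
qed

lemma vec_upd_self: "vec_upd z l (z $ l) = z"
  by (simp add: vec_eq_iff vec_upd_nth)

lemma norm_gabor_eq_iff:
  "norm (gabor f t \<omega>) = norm (gabor g t \<omega>) \<longleftrightarrow>
   norm (fock f (\<chi> l. Complex (t $ l) (- \<omega> $ l))) = norm (fock g (\<chi> l. Complex (t $ l) (- \<omega> $ l)))"
  using gaussian_pos[of t] by (simp add: gabor_eq_fock norm_mult)

text \<open>While one coordinate is treated, the others are arbitrary complex numbers instead of
  lattice values. Each coordinate is filled by the one-variable result, so each must satisfy its own
  inequality \<open>min (a $ l) (b $ l) < 1\<close>.\<close>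

lemma norm_fock_eq_of_sqrt_lattice:
  fixes f1 f2 :: "real ^ 'd \<Rightarrow> complex"
  assumes f: "f1 \<in> L2_functions" "f2 \<in> L2_functions"
    and ab: "\<And>l. a $ l > 0" "\<And>l. b $ l > 0" "\<And>l. min (a $ l) (b $ l) < 1"
    and eq: "\<And>t \<omega>. (t, \<omega>) \<in> sqrt_lattice a b \<Longrightarrow> norm (gabor f1 t \<omega>) = norm (gabor f2 t \<omega>)"
  shows "norm (fock f1 z) = norm (fock f2 z)"
proof (rule coordinate_extension[where P = "\<lambda>z. norm (fock f1 z) = norm (fock f2 z)"
      and A = "\<lambda>l. {Complex (a $ l * s) (b $ l * r) | s r. s \<in> sqrt_ints \<and> r \<in> sqrt_ints}"])
  fix z :: "complex ^ 'd"
  assume z: "\<And>l. z $ l \<in> {Complex (a $ l * s) (b $ l * r) | s r. s \<in> sqrt_ints \<and> r \<in> sqrt_ints}"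
  \<comment> \<open>The Fock variable is \<open>t - i \<omega>\<close>; the sign is harmless because
    \<open>sqrt_ints\<close> is symmetric.\<close>
  define t \<omega> where "t = (\<chi> l. Re (z $ l))" and "\<omega> = (\<chi> l. - Im (z $ l))"
  have "t $ l \<in> (\<lambda>s. a $ l * s) ` sqrt_ints" "\<omega> $ l \<in> (\<lambda>s. b $ l * s) ` sqrt_ints" for l
  proof -
    obtain s r where sr: "s \<in> sqrt_ints" "r \<in> sqrt_ints" "z $ l = Complex (a $ l * s) (b $ l * r)"
      using z[of l] by blast
    show "t $ l \<in> (\<lambda>s. a $ l * s) ` sqrt_ints"
      using sr by (intro image_eqI[of _ _ s]) (simp_all add: t_def)
    show "\<omega> $ l \<in> (\<lambda>s. b $ l * s) ` sqrt_ints"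
      using sr sqrt_ints_uminus[OF sr(2)] by (intro image_eqI[of _ _ "- r"]) (simp_all add: \<omega>_def)
  qed
  then have "(t, \<omega>) \<in> sqrt_lattice a b" by (simp add: sqrt_lattice_def)
  from eq[OF this] have "norm (fock f1 (\<chi> l. Complex (t $ l) (- \<omega> $ l))) = norm (fock f2 (\<chi> l. Complex (t $ l) (- \<omega> $ l)))"
    by (simp only: norm_gabor_eq_iff)
  moreover have "(\<chi> l. Complex (t $ l) (- \<omega> $ l)) = z" by (simp add: t_def \<omega>_def vec_eq_iff)
  ultimately show "norm (fock f1 z) = norm (fock f2 z)" by simp
next
  fix z :: "complex ^ 'd" and l
  assume H: "\<And>c. c \<in> {Complex (a $ l * s) (b $ l * r) | s r. s \<in> sqrt_ints \<and> r \<in> sqrt_ints} \<Longrightarrow>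
    norm (fock f1 (vec_upd z l c)) = norm (fock f2 (vec_upd z l c))"
  obtain C1 where C1: "C1 \<ge> 0" "\<And>z. norm (fock f1 z) \<le> C1 * exp (pi * (norm (re_vec z))\<^sup>2)"
    using norm_fock_le[OF f(1)] by blast
  obtain C2 where C2: "C2 \<ge> 0" "\<And>z. norm (fock f2 z) \<le> C2 * exp (pi * (norm (re_vec z))\<^sup>2)"
    using norm_fock_le[OF f(2)] by blast
  define C where "C = (C1 + C2) * exp (pi * (norm (re_vec (vec_upd z l 0)))\<^sup>2)"
  have growth: "norm (fock f (vec_upd z l c)) \<le> C * exp (pi * (Re c)\<^sup>2)"
    if D: "D \<le> C1 + C2" "\<And>z. norm (fock f z) \<le> D * exp (pi * (norm (re_vec z))\<^sup>2)" for f D c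
  proof -
    have "norm (fock f (vec_upd z l c)) \<le> (C1 + C2) * exp (pi * (norm (re_vec (vec_upd z l c)))\<^sup>2)"
      by (rule order_trans[OF D(2)]) (use D(1) in \<open>intro mult_right_mono, auto\<close>)
    also have "\<dots> = C * exp (pi * (Re c)\<^sup>2)"
      unfolding norm_re_vec_vec_upd[of z l c] C_def distrib_left exp_add by simp
    finally show ?thesis .
  qed
  have "norm (fock f1 (vec_upd z l (z $ l))) = norm (fock f2 (vec_upd z l (z $ l)))"
  proof (rule modulus_eq_of_sqrt_lattice[where ?F1.0 = "\<lambda>c. fock f1 (vec_upd z l c)"
        and ?F2.0 = "\<lambda>c. fock f2 (vec_upd z l c)" and C = C and a = "a $ l" and b = "b $ l"])
    show "norm (fock f1 (vec_upd z l c)) \<le> C * exp (pi * (Re c)\<^sup>2)" for c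
      by (rule growth[OF _ C1(2)]) (use C2 in simp)
    show "norm (fock f2 (vec_upd z l c)) \<le> C * exp (pi * (Re c)\<^sup>2)" for c
      by (rule growth[OF _ C2(2)]) (use C1 in simp)
    show "norm (fock f1 (vec_upd z l (Complex (a $ l * s) (b $ l * r)))) =
        norm (fock f2 (vec_upd z l (Complex (a $ l * s) (b $ l * r))))"
      if "s \<in> sqrt_ints" "r \<in> sqrt_ints" for s r
      by (rule H) (use that in blast)
  qed (use ab fock_holomorphic_coordinate f in auto)
  then show "norm (fock f1 z) = norm (fock f2 z)" by (simp only: vec_upd_self)
qed

lemma eq_up_to_phase_of_norm_fock_eq:
  fixes f1 f2 :: "real ^ 'd \<Rightarrow> complex"
  assumes f: "f1 \<in> L2_functions" "f2 \<in> L2_functions"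
    and eq: "\<And>z. norm (fock f1 z) = norm (fock f2 z)"
  shows "\<exists>\<alpha>::real. AE x in lebesgue. f1 x = exp (\<i> * of_real \<alpha>) * f2 x"
proof -
  have "\<exists>\<alpha>::real. \<forall>z. fock f1 z = exp (\<i> * of_real \<alpha>) * fock f2 z"
  proof (cases "\<forall>z. fock f2 z = 0")
    case True
    then have "\<forall>z. fock f1 z = 0" using eq by (metis norm_eq_zero)
    with True show ?thesis by simp
  next
    case False
    then obtain z0 where z0: "fock f2 z0 \<noteq> 0" by blast
    define u where "u = fock f1 z0 / fock f2 z0"
    have "norm u = 1" using z0 eq[of z0] by (simp add: u_def norm_divide)
    then have "exp (\<i> * of_real (Arg u)) = u"
      using Arg_eq[of u] by (cases "u = 0") auto
    moreover have "fock f1 z = u * fock f2 z" for z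
    proof -
      \<comment> \<open>The complex line through \<open>z0\<close> and \<open>z\<close>. All these
        lines share \<open>z0\<close>, so the same \<open>u\<close> works for every
        \<open>z\<close>.\<close>
      define \<gamma> where "\<gamma> = (\<lambda>c. z0 + (\<chi> l. c * (z - z0) $ l))"
      have line: "cdot x (\<gamma> c) = cdot x z0 + c * cdot x (z - z0)" for x c
        unfolding \<gamma>_def cdot_add cdot_scale ..
      have "fock f1 (\<gamma> 0) * fock f2 (\<gamma> 1) = fock f2 (\<gamma> 0) * fock f1 (\<gamma> 1)"
      proof (rule entire_proportional_of_modulus_eq_on_lines[where ?F1.0 = "\<lambda>c. fock f1 (\<gamma> c)"
            and ?F2.0 = "\<lambda>c. fock f2 (\<gamma> c)" and Y = UNIV])
        show "\<exists>y\<in>UNIV. \<exists>y'\<in>UNIV. y \<noteq> y' \<and> \<bar>y - y'\<bar> < e" if "e > 0" for e :: real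
          using that by (intro bexI[of _ 0] bexI[of _ "e / 2"]) auto
      qed (use eq fock_holomorphic_line[OF f(1) line] fock_holomorphic_line[OF f(2) line] in auto)
      moreover have "\<gamma> 0 = z0" "\<gamma> 1 = z" by (simp_all add: \<gamma>_def vec_eq_iff)
      ultimately show ?thesis using z0 by (simp add: u_def field_simps)
    qed
    ultimately show ?thesis by metis
  qed
  then obtain \<alpha> :: real where \<alpha>: "\<And>z. fock f1 z = exp (\<i> * of_real \<alpha>) * fock f2 z" by blast
  let ?h = "\<lambda>x. 1 * f1 x + (- exp (\<i> * of_real \<alpha>)) * f2 x"
  have "AE x in lebesgue. ?h x = 0"
    by (rule fock_eq_0_imp_AE_0[OF L2_functions_lincomb[OF f]])
      (simp only: fock_lincomb[OF f], simp add: \<alpha>)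
  then have "AE x in lebesgue. f1 x = exp (\<i> * of_real \<alpha>) * f2 x"
    by eventually_elim simp
  then show ?thesis ..
qed

theorem gabor_phase_retrieval_sqrt_lattice:
  fixes a b :: "real ^ 'd"
  assumes "\<And>l. a $ l > 0" "\<And>l. b $ l > 0" "\<And>l. min (a $ l) (b $ l) < 1"
  shows "gabor_phase_retrieval (sqrt_lattice a b)"
  unfolding gabor_phase_retrieval_def
proof (intro ballI impI)
  fix f1 f2 :: "real ^ 'd \<Rightarrow> complex"
  assume f: "f1 \<in> L2_functions" "f2 \<in> L2_functions"
    and eq: "\<forall>(t, \<omega>)\<in>sqrt_lattice a b. norm (gabor f1 t \<omega>) = norm (gabor f2 t \<omega>)"
  show "\<exists>\<alpha>::real. AE x in lebesgue. f1 x = exp (\<i> * of_real \<alpha>) * f2 x"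
    by (rule eq_up_to_phase_of_norm_fock_eq[OF f norm_fock_eq_of_sqrt_lattice[OF f assms]])
      (use eq in auto)
qed

section \<open>Chirped Gaussians and the counterexample\<close>

text \<open>The imaginary part of \<open>\<delta> l\<close> is the chirp rate in coordinate
  \<open>l\<close>.\<close>

definition complex_gaussian :: "('d \<Rightarrow> complex) \<Rightarrow> real ^ 'd \<Rightarrow> complex" where
  "complex_gaussian \<delta> x = exp (- (\<Sum>l\<in>UNIV. \<delta> l * of_real ((x $ l)\<^sup>2)))"

lemma norm_vec_power2: "(norm x)\<^sup>2 = (\<Sum>l\<in>UNIV. (x $ l)\<^sup>2)" for x :: "real ^ 'd"
  unfolding power2_norm_eq_inner by (simp add: inner_vec_def power2_eq_square)

lemma continuous_on_complex_gaussian: "continuous_on S (complex_gaussian \<delta>)"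
  unfolding complex_gaussian_def[abs_def] by (intro continuous_intros)

lemma complex_gaussian_mult_gaussian:
  "complex_gaussian \<delta> x * of_real (gaussian x) = complex_gaussian (\<lambda>l. \<delta> l + of_real pi) x"
proof -
  have "of_real (gaussian x) = exp (- (\<Sum>l\<in>UNIV. of_real pi * of_real ((x $ l)\<^sup>2)) :: complex)"
    unfolding gaussian_def norm_vec_power2 by (simp add: sum_distrib_left sum_negf flip: exp_of_real)
  then show ?thesis
    unfolding complex_gaussian_def by (simp add: mult_exp_exp ring_distribs sum.distrib)
qed

lemma complex_gaussian_L2:
  assumes m: "m > 0" "\<And>l. Re (\<delta> l) \<ge> m"
  shows "complex_gaussian \<delta> \<in> L2_functions"
proof -
  have meas: "complex_gaussian \<delta> \<in> borel_measurable lebesgue"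
    by (intro continuous_imp_lebesgue_measurable continuous_on_complex_gaussian)
  have le: "(norm (complex_gaussian \<delta> x))\<^sup>2 \<le> exp (- (2 * m) * (norm x)\<^sup>2)" for x
  proof -
    have "m * (norm x)\<^sup>2 \<le> (\<Sum>l\<in>UNIV. Re (\<delta> l) * (x $ l)\<^sup>2)"
      unfolding norm_vec_power2 sum_distrib_left using m(2) by (intro sum_mono mult_right_mono) auto
    then show ?thesis unfolding complex_gaussian_def by (simp flip: exp_double)
  qed
  have "integrable lebesgue (\<lambda>x. (norm (complex_gaussian \<delta> x))\<^sup>2)"
    by (rule Bochner_Integration.integrable_bound[OF integrable_gaussian[of "2 * m"]])
      (use m meas le in \<open>auto intro!: AE_I2\<close>)
  with meas show ?thesis by (simp add: L2_functions_def)
qed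

text \<open>The shift that completes the square is real only when each \<open>z $ l\<close> is a
  real multiple of \<open>\<delta> l + pi\<close>. There translation invariance gives the formula,
  with the integral at 0 left unevaluated; holomorphy extends it in each coordinate.\<close>

lemma fock_complex_gaussian:
  fixes \<delta> :: "'d::finite \<Rightarrow> complex"
  assumes m: "m > 0" "\<And>l. Re (\<delta> l) \<ge> m"
  shows "fock (complex_gaussian \<delta>) z =
    fock (complex_gaussian \<delta>) 0 * exp (of_real (pi\<^sup>2) * (\<Sum>l\<in>UNIV. (z $ l)\<^sup>2 / (\<delta> l + of_real pi)))"
proof -
  define \<gamma> where "\<gamma> = (\<lambda>l. \<delta> l + of_real pi)"
  have "Re (\<gamma> l) > 0" for l
  proof -
    have "Re (\<gamma> l) = Re (\<delta> l) + pi" by (simp add: \<gamma>_def)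
    then show ?thesis using m(1) m(2)[of l] pi_gt_zero by linarith
  qed
  then have \<gamma>0: "\<gamma> l \<noteq> 0" for l by (metis less_irrefl zero_complex.simps(1))
  let ?K = "fock (complex_gaussian \<delta>) 0"
  have fock: "fock (complex_gaussian \<delta>) z = (LINT x|lebesgue. complex_gaussian \<gamma> x * exp (2 * of_real pi * cdot x z))" for z
    unfolding fock_def complex_gaussian_mult_gaussian \<gamma>_def ..
  have "fock (complex_gaussian \<delta>) z = ?K * exp (of_real (pi\<^sup>2) * (\<Sum>l\<in>UNIV. (z $ l)\<^sup>2 / \<gamma> l))"
  proof (rule coordinate_extension[where P = "\<lambda>z. fock (complex_gaussian \<delta>) z =
        ?K * exp (of_real (pi\<^sup>2) * (\<Sum>l\<in>UNIV. (z $ l)\<^sup>2 / \<gamma> l))" and A = "\<lambda>l. {of_real r * \<gamma> l | r. True}"])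
    fix z :: "complex ^ 'd" assume "\<And>l. z $ l \<in> {of_real r * \<gamma> l | r. True}"
    then have "\<forall>l. \<exists>r::real. z $ l = of_real r * \<gamma> l" by blast
    then obtain r :: "'d \<Rightarrow> real" where r: "\<And>l. z $ l = of_real (r l) * \<gamma> l" by metis
    \<comment> \<open>Minus the centre \<open>pi * z $ l / \<gamma> l = pi * r l\<close> of the
      completed square.\<close>
    define p where "p = (\<chi> l. - pi * r l)"
    let ?S = "of_real (pi\<^sup>2) * (\<Sum>l\<in>UNIV. (z $ l)\<^sup>2 / \<gamma> l)"
    have "complex_gaussian \<gamma> x * exp (2 * of_real pi * cdot x z) = exp ?S * complex_gaussian \<gamma> (p + x)" for x
    proof -
      have "- (\<gamma> l * of_real ((x $ l)\<^sup>2)) + 2 * of_real pi * (of_real (x $ l) * z $ l) =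
          of_real (pi\<^sup>2) * ((z $ l)\<^sup>2 / \<gamma> l) - \<gamma> l * of_real (((p + x) $ l)\<^sup>2)" for l
        unfolding r p_def using \<gamma>0[of l] by (simp add: power2_eq_square field_simps)
      then have "(\<Sum>l\<in>UNIV. - (\<gamma> l * of_real ((x $ l)\<^sup>2)) + 2 * of_real pi * (of_real (x $ l) * z $ l)) =
          (\<Sum>l\<in>UNIV. of_real (pi\<^sup>2) * ((z $ l)\<^sup>2 / \<gamma> l) - \<gamma> l * of_real (((p + x) $ l)\<^sup>2))" by simp
      then have "- (\<Sum>l\<in>UNIV. \<gamma> l * of_real ((x $ l)\<^sup>2)) + 2 * of_real pi * cdot x z =
          ?S + - (\<Sum>l\<in>UNIV. \<gamma> l * of_real (((p + x) $ l)\<^sup>2))"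
        by (simp only: sum.distrib sum_subtractf sum_negf sum_distrib_left[symmetric] cdot_def diff_conv_add_uminus)
      then show ?thesis unfolding complex_gaussian_def by (simp only: mult_exp_exp)
    qed
    then have "fock (complex_gaussian \<delta>) z = exp ?S * (LINT x|lebesgue. complex_gaussian \<gamma> (p + x))"
      unfolding fock by simp
    also have "(LINT x|lebesgue. complex_gaussian \<gamma> (p + x)) = (LINT x|lebesgue. complex_gaussian \<gamma> x)"
      by (rule lebesgue_integral_translate[OF continuous_on_complex_gaussian])
    also have "\<dots> = ?K" unfolding fock by (simp add: cdot_def)
    finally show "fock (complex_gaussian \<delta>) z = ?K * exp ?S" by simp
  next
    fix z :: "complex ^ 'd" and l
    let ?R = "\<lambda>z. ?K * exp (of_real (pi\<^sup>2) * (\<Sum>l\<in>UNIV. (z $ l)\<^sup>2 / \<gamma> l))"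
    assume H: "\<And>c. c \<in> {of_real r * \<gamma> l | r. True} \<Longrightarrow>
      fock (complex_gaussian \<delta>) (vec_upd z l c) = ?R (vec_upd z l c)"
    have "fock (complex_gaussian \<delta>) (vec_upd z l (z $ l)) = ?R (vec_upd z l (z $ l))"
    proof (rule entire_eq_on_ray[where f = "\<lambda>c. fock (complex_gaussian \<delta>) (vec_upd z l c)"
          and g = "\<lambda>c. ?R (vec_upd z l c)" and p = 0 and v = "\<gamma> l" and r = 0])
      show "(\<lambda>c. fock (complex_gaussian \<delta>) (vec_upd z l c)) holomorphic_on UNIV"
        by (rule fock_holomorphic_coordinate[OF complex_gaussian_L2[OF m]])
      have "(\<lambda>c. vec_upd z l c $ k) holomorphic_on UNIV" for k
        unfolding vec_upd_nth by (cases "k = l") (auto intro: holomorphic_intros)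
      then show "(\<lambda>c. ?R (vec_upd z l c)) holomorphic_on UNIV"
        using \<gamma>0 by (intro holomorphic_intros) auto
      show "fock (complex_gaussian \<delta>) (vec_upd z l (0 + of_real x * \<gamma> l)) = ?R (vec_upd z l (0 + of_real x * \<gamma> l))" for x
        by (rule H) auto
    qed (rule \<gamma>0)
    then show "fock (complex_gaussian \<delta>) z = ?R z" by (simp only: vec_upd_self)
  qed
  then show ?thesis unfolding \<gamma>_def .
qed

text \<open>If this constant were 0, the whole transform would vanish, and by injectivity so would a
  function without zeros.\<close>

lemma fock_complex_gaussian_0_neq_0:
  fixes \<delta> :: "'d::finite \<Rightarrow> complex"
  assumes m: "m > 0" "\<And>l. Re (\<delta> l) \<ge> m"
  shows "fock (complex_gaussian \<delta>) 0 \<noteq> 0"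
proof
  assume 0: "fock (complex_gaussian \<delta>) 0 = 0"
  have "fock (complex_gaussian \<delta>) z = 0" for z
    by (subst fock_complex_gaussian[OF m]) (simp add: 0)
  then have "AE x in lebesgue. complex_gaussian \<delta> x = 0"
    by (rule fock_eq_0_imp_AE_0[OF complex_gaussian_L2[OF m]])
  then have "AE x in (lebesgue :: (real ^ 'd) measure). False"
    by eventually_elim (simp add: complex_gaussian_def)
  then have "UNIV \<in> null_sets (lebesgue :: (real ^ 'd) measure)"
    by (simp add: AE_iff_null_sets)
  then show False by (simp add: null_sets_def)
qed

lemma fock_cong_AE:
  fixes f g :: "real ^ 'd \<Rightarrow> complex"
  assumes f: "f \<in> L2_functions" and g: "g \<in> L2_functions" and eq: "AE x in lebesgue. f x = g x"
  shows "fock f z = fock g z"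
  unfolding fock_def
proof (rule integral_cong_AE)
  show "AE x in lebesgue. f x * of_real (gaussian x) * exp (2 * of_real pi * cdot x z) =
      g x * of_real (gaussian x) * exp (2 * of_real pi * cdot x z)"
    using eq by eventually_elim simp
qed (use integrable_fock[OF f] integrable_fock[OF g] in auto)

text \<open>
  Up to constants the two functions have Fock transforms \<open>cos (\<theta> + \<pi>/4)\<close> and
  \<open>cos (\<theta> - \<pi>/4)\<close> times a common zero-free factor, where \<open>\<theta> = \<pi> w\<^sup>2 / (2 c\<^sup>2)\<close> and \<open>w\<close> is
  the coordinate \<open>l0\<close>. On the lattice the real part of \<open>2 \<theta>\<close> is a multiple of \<open>\<pi>\<close>, which
  makes the moduli agree. The exponents \<open>\<delta> (\<plusminus>1)\<close> solve
  \<open>\<pi>\<^sup>2 / (\<delta> + \<pi>) = (\<pi> / 2) (1 \<plusminus> i s)\<close>, and have positive real part because \<open>c > 1\<close>.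
\<close>

theorem not_gabor_phase_retrieval_sqrt_lattice:
  fixes a b :: "real ^ 'd"
  assumes eq: "a $ l0 = b $ l0" and gt: "b $ l0 > 1"
  shows "\<not> gabor_phase_retrieval (sqrt_lattice a b)"
proof
  assume PR: "gabor_phase_retrieval (sqrt_lattice a b)"
  define c where "c = b $ l0"
  have c: "c > 1" "a $ l0 = c" "b $ l0 = c" using eq gt by (auto simp: c_def)
  define s where "s = 1 / c\<^sup>2"
  have "c\<^sup>2 > 1" using c by (simp add: one_less_power)
  then have s: "0 < s" "s < 1" using c by (simp_all add: s_def divide_less_eq)
  define \<delta> where "\<delta> = (\<lambda>(\<sigma>::real) l. if l = l0 then 2 * of_real pi / (1 + \<i> * of_real (\<sigma> * s)) - of_real pi else of_real pi :: complex)"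
  \<comment> \<open>This is \<open>Re (2 pi / (1 + i s)) - pi\<close>, the real part of the exponent
    in coordinate \<open>l0\<close>; in the other coordinates the exponent is pi.\<close>
  define m where "m = pi * (1 - s\<^sup>2) / (1 + s\<^sup>2)"
  have s2: "s\<^sup>2 < 1" using s by (simp add: power_less_one_iff)
  have "1 + s\<^sup>2 > 0" by (simp add: add_pos_nonneg)
  then have m: "m > 0" "m \<le> pi" using s2 by (auto simp: m_def field_simps)
  have Re\<delta>: "Re (\<delta> \<sigma> l) \<ge> m" if "\<sigma> = 1 \<or> \<sigma> = - 1" for \<sigma> l
  proof (cases "l = l0")
    case True
    have "(\<sigma> * s)\<^sup>2 = s\<^sup>2" using that by auto
    then have "Re (2 * of_real pi / (1 + \<i> * of_real (\<sigma> * s))) = 2 * pi / (1 + s\<^sup>2)"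
      by (simp add: Re_divide)
    then show ?thesis
      using True \<open>1 + s\<^sup>2 > 0\<close> by (simp add: \<delta>_def m_def field_simps)
  qed (use m in \<open>simp add: \<delta>_def\<close>)
  define G where "G = (\<lambda>\<sigma>. complex_gaussian (\<delta> \<sigma>))"
  define K where "K = (\<lambda>\<sigma>. fock (G \<sigma>) 0)"
  have G: "G \<sigma> \<in> L2_functions" if "\<sigma> = 1 \<or> \<sigma> = - 1" for \<sigma>
    unfolding G_def by (rule complex_gaussian_L2[OF m(1) Re\<delta>[OF that]])
  have K: "K \<sigma> \<noteq> 0" if "\<sigma> = 1 \<or> \<sigma> = - 1" for \<sigma>
    unfolding K_def G_def by (rule fock_complex_gaussian_0_neq_0[OF m(1) Re\<delta>[OF that]])
  define \<kappa> where "\<kappa> = pi * s / 2"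
  define Q where "Q = (\<lambda>z::complex ^ 'd. exp (of_real (pi / 2) * (\<Sum>l\<in>UNIV. (z $ l)\<^sup>2)))"
  have fockG: "fock (G \<sigma>) z = K \<sigma> * (Q z * exp (of_real \<sigma> * \<i> * of_real \<kappa> * (z $ l0)\<^sup>2))"
    if \<sigma>: "\<sigma> = 1 \<or> \<sigma> = - 1" for \<sigma> z
  proof -
    have summand: "of_real (pi\<^sup>2) * ((z $ l)\<^sup>2 / (\<delta> \<sigma> l + of_real pi)) =
        of_real (pi / 2) * (z $ l)\<^sup>2 + (if l = l0 then of_real \<sigma> * \<i> * of_real \<kappa> * (z $ l0)\<^sup>2 else 0)" for l
    proof -
      have "of_real (pi\<^sup>2) * (Z / (2 * of_real pi / N)) = of_real (pi / 2) * Z * N" for Z N :: complex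
        by (simp add: power2_eq_square)
      note * = this
      show ?thesis
      proof (cases "l = l0")
        case True
        then have "\<delta> \<sigma> l + of_real pi = 2 * of_real pi / (1 + \<i> * of_real (\<sigma> * s))" by (simp add: \<delta>_def)
        then show ?thesis using True by (simp only: *) (simp add: \<kappa>_def algebra_simps)
      next
        case False
        then have "\<delta> \<sigma> l + of_real pi = 2 * of_real pi / 1" by (simp add: \<delta>_def)
        then show ?thesis using False by (simp only: *) simp
      qed
    qed
    have "of_real (pi\<^sup>2) * (\<Sum>l\<in>UNIV. (z $ l)\<^sup>2 / (\<delta> \<sigma> l + of_real pi)) =
        of_real (pi / 2) * (\<Sum>l\<in>UNIV. (z $ l)\<^sup>2) + of_real \<sigma> * \<i> * of_real \<kappa> * (z $ l0)\<^sup>2"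
      unfolding sum_distrib_left summand by (simp add: sum.distrib)
    then show ?thesis
      unfolding G_def K_def Q_def by (subst fock_complex_gaussian[OF m(1) Re\<delta>[OF \<sigma>]]) (simp only: exp_add)
  qed
  \<comment> \<open>Division by \<open>K\<close> gives both Gaussians equal weight. The values
    \<open>e = 1 + i\<close> and \<open>e = 1 - i\<close> are \<open>sqrt 2\<close> times
    \<open>exp (i pi / 4)\<close> and its conjugate, the phases of the two cosines.\<close>
  define f where "f = (\<lambda>e x. e / K 1 * G 1 x + cnj e / K (- 1) * G (- 1) x)"
  have f: "f e \<in> L2_functions" for e
    unfolding f_def by (rule L2_functions_lincomb) (auto intro: G)
  have fockf: "fock (f e) z = Q z * (e * exp (\<i> * of_real \<kappa> * (z $ l0)\<^sup>2) + cnj e * exp (- \<i> * of_real \<kappa> * (z $ l0)\<^sup>2))" for e z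
    unfolding f_def using K[of 1] K[of "- 1"]
    by (subst fock_lincomb) (simp_all add: G fockG algebra_simps)
  have lattice: "norm (gabor (f (1 + \<i>)) t \<omega>) = norm (gabor (f (1 - \<i>)) t \<omega>)"
    if "(t, \<omega>) \<in> sqrt_lattice a b" for t \<omega>
  proof -
    define w where "w = Complex (t $ l0) (- \<omega> $ l0)"
    have "\<forall>l. t $ l \<in> (\<lambda>s. a $ l * s) ` sqrt_ints" "\<forall>l. \<omega> $ l \<in> (\<lambda>s. b $ l * s) ` sqrt_ints"
      using that by (auto simp: sqrt_lattice_def)
    from this(1)[rule_format, of l0] this(2)[rule_format, of l0]
    have "t $ l0 \<in> (\<lambda>s. c * s) ` sqrt_ints" "\<omega> $ l0 \<in> (\<lambda>s. c * s) ` sqrt_ints"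
      by (simp_all only: c)
    then obtain p q where pq: "p \<in> sqrt_ints" "q \<in> sqrt_ints" "t $ l0 = c * p" "\<omega> $ l0 = c * q" by blast
    obtain i j :: int where ij: "p\<^sup>2 = of_int i" "q\<^sup>2 = of_int j"
      using pq(1,2) by (auto simp: sqrt_ints_def)
    \<comment> \<open>\<open>B\<close> and \<open>A\<close> are the real and imaginary parts of
      \<open>i \<kappa> w^2\<close>, because \<open>\<kappa> * c^2 = pi / 2\<close>.\<close>
    define B where "B = pi * p * q"
    define A where "A = pi * of_int (i - j) / 2"
    have "w\<^sup>2 = of_real (c\<^sup>2) * Complex (p\<^sup>2 - q\<^sup>2) (- 2 * p * q)"
      by (simp add: w_def pq complex_eq_iff power2_eq_square algebra_simps)
    then have "\<i> * of_real \<kappa> * w\<^sup>2 = \<i> * of_real (pi / 2) * Complex (p\<^sup>2 - q\<^sup>2) (- 2 * p * q)"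
      using c by (simp add: \<kappa>_def s_def)
    also have "\<dots> = of_real B + \<i> * of_real A"
      by (simp add: complex_eq_iff A_def B_def ij)
    finally have w2: "\<i> * of_real \<kappa> * w\<^sup>2 = of_real B + \<i> * of_real A" .
    \<comment> \<open>As \<open>2 * A\<close> is an integer multiple of pi,
      \<open>\<eta>^2 = \<rho>\<close> is 1 or -1 and the inverse of \<eta> is
      \<open>\<rho> * \<eta>\<close>. So both exponentials are real multiples of the same
      \<eta>.\<close>
    define \<eta> where "\<eta> = exp (\<i> * of_real A)"
    define \<rho> where "\<rho> = cos (2 * A)"
    have sin0: "sin (2 * A) = 0" unfolding A_def sin_zero_iff_int2 by (auto intro!: exI[of _ "i - j"])
    have \<eta>2: "\<eta> * \<eta> = of_real \<rho>"
    proof -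
      have "\<eta> * \<eta> = cis (2 * A)" unfolding \<eta>_def by (simp add: mult_exp_exp cis_conv_exp mult.left_commute)
      then show ?thesis by (simp add: complex_eq_iff \<rho>_def sin0)
    qed
    have \<rho>2: "\<rho> * \<rho> = 1" using sin_cos_squared_add[of "2 * A"] sin0 by (simp add: \<rho>_def power2_eq_square)
    have up: "exp (\<i> * of_real \<kappa> * w\<^sup>2) = of_real (exp B) * \<eta>"
      unfolding w2 exp_add \<eta>_def by (simp add: exp_of_real)
    have "\<eta> * exp (- (\<i> * of_real A)) = 1" unfolding \<eta>_def by (simp add: mult_exp_exp)
    have inv: "exp (- (\<i> * of_real A)) = of_real \<rho> * \<eta>"
    proof -
      have "of_real \<rho> * \<eta> = of_real \<rho> * \<eta> * (\<eta> * exp (- (\<i> * of_real A)))"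
        using \<open>\<eta> * exp (- (\<i> * of_real A)) = 1\<close> by simp
      also have "\<dots> = of_real \<rho> * (\<eta> * \<eta>) * exp (- (\<i> * of_real A))" by (simp only: mult.assoc)
      also have "of_real \<rho> * (\<eta> * \<eta>) = 1" unfolding \<eta>2 using \<rho>2 by (simp flip: of_real_mult)
      finally show ?thesis by simp
    qed
    have down: "exp (- \<i> * of_real \<kappa> * w\<^sup>2) = of_real (\<rho> * exp (- B)) * \<eta>"
    proof -
      have "- \<i> * of_real \<kappa> * w\<^sup>2 = - (of_real B) + - (\<i> * of_real A)" using w2 by simp
      then have "exp (- \<i> * of_real \<kappa> * w\<^sup>2) = exp (- of_real B) * exp (- (\<i> * of_real A))"
        by (simp only: exp_add)
      then show ?thesis unfolding inv by (simp add: exp_of_real flip: of_real_minus)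
    qed
    let ?z = "\<chi> l. Complex (t $ l) (- \<omega> $ l)"
    have zl: "?z $ l0 = w" by (simp add: w_def)
    have nf: "norm (fock (f e) ?z) = norm (Q ?z) * norm \<eta> * norm (of_real (exp B) * e + of_real (\<rho> * exp (- B)) * cnj e)" for e
    proof -
      have "e * (of_real (exp B) * \<eta>) + cnj e * (of_real (\<rho> * exp (- B)) * \<eta>) =
          \<eta> * (of_real (exp B) * e + of_real (\<rho> * exp (- B)) * cnj e)" by (simp add: algebra_simps)
      then show ?thesis unfolding fockf zl up down by (simp only: norm_mult mult.assoc)
    qed
    \<comment> \<open>The coefficients are real, so conjugating \<open>e\<close> conjugates the
      whole sum.\<close>
    have "of_real (exp B) * (1 - \<i>) + of_real (\<rho> * exp (- B)) * cnj (1 - \<i>) =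
        cnj (of_real (exp B) * (1 + \<i>) + of_real (\<rho> * exp (- B)) * cnj (1 + \<i>))" by simp
    then have "norm (of_real (exp B) * (1 - \<i>) + of_real (\<rho> * exp (- B)) * cnj (1 - \<i>)) =
        norm (of_real (exp B) * (1 + \<i>) + of_real (\<rho> * exp (- B)) * cnj (1 + \<i>))"
      by (simp only: complex_mod_cnj)
    then show ?thesis unfolding norm_gabor_eq_iff nf by (simp only:)
  qed
  obtain \<alpha> :: real where "AE x in lebesgue. f (1 + \<i>) x = exp (\<i> * of_real \<alpha>) * f (1 - \<i>) x"
    using PR[unfolded gabor_phase_retrieval_def, rule_format, OF f f] lattice by blast
  then have AE: "AE x in lebesgue. f (1 + \<i>) x = exp (\<i> * of_real \<alpha>) * f (1 - \<i>) x + 0 * f (1 - \<i>) x" by simp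
  have ph: "fock (f (1 + \<i>)) z = exp (\<i> * of_real \<alpha>) * fock (f (1 - \<i>)) z" for z
  proof -
    have "fock (f (1 + \<i>)) z = fock (\<lambda>x. exp (\<i> * of_real \<alpha>) * f (1 - \<i>) x + 0 * f (1 - \<i>) x) z"
      by (rule fock_cong_AE[OF f L2_functions_lincomb[OF f f] AE])
    also have "\<dots> = exp (\<i> * of_real \<alpha>) * fock (f (1 - \<i>)) z + 0 * fock (f (1 - \<i>)) z"
      by (rule fock_lincomb[OF f f])
    finally show ?thesis by simp
  qed
  have Q0: "Q z \<noteq> 0" for z by (simp add: Q_def)
  \<comment> \<open>At 0 both transforms have the same nonzero value, which fixes the phase.\<close>
  have \<alpha>: "exp (\<i> * of_real \<alpha>) = 1"
    using ph[of 0] Q0[of 0] unfolding fockf by simp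
  \<comment> \<open>Here the angle \<theta> is \<open>pi / 2\<close>, and the two transforms have
    opposite nonzero values.\<close>
  define v :: "complex ^ 'd" where "v = axis l0 (of_real c)"
  have "\<i> * of_real \<kappa> * (v $ l0)\<^sup>2 = \<i> * of_real (pi / 2)"
    using c by (simp add: v_def \<kappa>_def s_def)
  then have e: "exp (\<i> * of_real \<kappa> * (v $ l0)\<^sup>2) = \<i>"
    by (simp only: cis_conv_exp[symmetric] cis_pi_half)
  moreover have "exp (- \<i> * of_real \<kappa> * (v $ l0)\<^sup>2) = - \<i>"
    using arg_cong[OF e, of inverse] by (simp add: exp_minus[symmetric])
  ultimately show False
    using \<alpha> ph[of v] Q0[of v] unfolding fockf by (simp add: complex_eq_iff)
qed

theorem theorem5p3:
  fixes a b :: "real ^ 'd"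
  assumes "\<And>l. a $ l > 0" and "\<And>l. b $ l > 0"
  shows "(Max (range (\<lambda>l. min (a $ l) (b $ l))) < 1 \<longrightarrow> gabor_phase_retrieval (sqrt_lattice a b)) \<and>
         ((\<exists>l0. a $ l0 = b $ l0 \<and> b $ l0 > 1) \<longrightarrow> \<not> gabor_phase_retrieval (sqrt_lattice a b))"
proof (intro conjI impI)
  assume "Max (range (\<lambda>l. min (a $ l) (b $ l))) < 1"
  then have "min (a $ l) (b $ l) < 1" for l by (subst (asm) Max_less_iff) auto
  then show "gabor_phase_retrieval (sqrt_lattice a b)"
    by (intro gabor_phase_retrieval_sqrt_lattice assms)
next
  assume "\<exists>l0. a $ l0 = b $ l0 \<and> b $ l0 > 1"
  then show "\<not> gabor_phase_retrieval (sqrt_lattice a b)"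
    using not_gabor_phase_retrieval_sqrt_lattice by blast
qed

end
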